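(* Let $X$ be an infinite uniformly locally finite metric space. Let $\mathcal{D}$ be a nonzero diffuse abelian von Neumann algebra. Then there is no injective $*$-homomorphism (not assumed unital, and not assumed normal) from $\mathcal{D}$ into the quasi-local algebra $\mathrm{C}^*_{ql}(X)$.
   Context: A metric space $X$ is uniformly locally finite (u.l.f.) if for each $r>0$ one has $\sup_{x\in X}|B_r(x)|<\infty$, where $B_r(x)$ is the closed ball of radius $r$. $\ell_2(X)$ is the complex Hilbert space of square-summable functions on $X$ with orthonormal basis $(\delta_x)_{x\in X}$; for $A\subseteq X$, $\chi_A\in\mathcal{B}(\ell_2(X))$ is the orthogonal projection onto $\ell_2(A)$; $d(A,B)=\inf\{d(x,y): x\in A, y\in B\}$. The quasi-local algebra $\mathrm{C}^*_{ql}(X)$ is the $\mathrm{C}^*$-algebra of all $a\in\mathcal{B}(\ell_2(X))$ such that for every $\varepsilon>0$ there is $r>0$ such that for all $A,B\subseteq X$ with $d(A,B)>r$ one has $\|\chi_A a\chi_B\|\le\varepsilon$. An abelian von Neumann algebra is diffuse if it contains no minimal projections. *)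

theory Defs
  imports "HOL-Analysis.Analysis"
begin

section \<open>Complex Hilbert spaces\<close>

class complex_vector = real_vector +
  fixes scaleC :: "complex \<Rightarrow> 'a \<Rightarrow> 'a" (infixr \<open>*\<^sub>C\<close> 75)
  assumes scaleC_add_right: "c *\<^sub>C (x + y) = c *\<^sub>C x + c *\<^sub>C y"
    and scaleC_add_left: "(c + d) *\<^sub>C x = c *\<^sub>C x + d *\<^sub>C x"
    and scaleC_scaleC: "c *\<^sub>C d *\<^sub>C x = (c * d) *\<^sub>C x"
    and scaleR_eq_scaleC: "r *\<^sub>R x = complex_of_real r *\<^sub>C x"

(* The inner product is linear in its first argument. Positivity and definiteness are part of
   cinner_self, by the norm axioms of real_normed_vector. *)
class complex_inner = complex_vector + real_normed_vector +
  fixes cinner :: "'a \<Rightarrow> 'a \<Rightarrow> complex"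
  assumes cinner_commute: "cinner x y = cnj (cinner y x)"
    and cinner_add_left: "cinner (x + y) z = cinner x z + cinner y z"
    and cinner_scaleC_left: "cinner (c *\<^sub>C x) y = c * cinner x y"
    and cinner_self: "cinner x x = complex_of_real ((norm x)\<^sup>2)"

class chilbert_space = complex_inner + complete_space

lemma scaleC_one [simp]: "1 *\<^sub>C x = (x::'a::complex_vector)"
  using scaleR_eq_scaleC[of 1 x] by simp

lemma scaleC_minus_one: "(-1) *\<^sub>C x = - (x::'a::complex_vector)"
  using scaleR_eq_scaleC[of "-1" x] by simp

lemma cinner_add_right: "cinner x (y + z) = cinner x y + cinner (x::'a::complex_inner) z"
  by (metis cinner_commute cinner_add_left complex_cnj_add)

lemma cinner_scaleC_right: "cinner x (c *\<^sub>C y) = cnj c * cinner (x::'a::complex_inner) y"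
  by (metis cinner_commute cinner_scaleC_left complex_cnj_mult)

lemma cinner_minus_left: "cinner (- x) y = - cinner (x::'a::complex_inner) y"
  using cinner_scaleC_left[of "-1" x y] by (simp add: scaleC_minus_one)

lemma cinner_minus_right: "cinner x (- y) = - cinner (x::'a::complex_inner) y"
  using cinner_scaleC_right[of x "-1" y] by (simp add: scaleC_minus_one)

lemma cinner_diff_left: "cinner (x - y) z = cinner x z - cinner (y::'a::complex_inner) z"
  using cinner_add_left[of x "-y" z] by (simp add: cinner_minus_left)

lemma cinner_diff_right: "cinner x (y - z) = cinner x y - cinner (x::'a::complex_inner) z"
  using cinner_add_right[of x y "-z"] by (simp add: cinner_minus_right)

lemma cinner_scaleR_left: "cinner (r *\<^sub>R x) y = complex_of_real r * cinner (x::'a::complex_inner) y"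
  by (simp add: scaleR_eq_scaleC cinner_scaleC_left)

lemma cinner_scaleR_right: "cinner x (r *\<^sub>R y) = complex_of_real r * cinner (x::'a::complex_inner) y"
  by (simp add: scaleR_eq_scaleC cinner_scaleC_right)

lemma norm_scaleC [simp]: "norm (c *\<^sub>C x) = cmod c * norm (x::'a::complex_inner)"
proof -
  have "complex_of_real ((norm (c *\<^sub>C x))\<^sup>2) = (c * cnj c) * complex_of_real ((norm x)\<^sup>2)"
    by (simp only: cinner_self[symmetric] cinner_scaleC_left cinner_scaleC_right ac_simps)
  also have "\<dots> = complex_of_real ((cmod c * norm x)\<^sup>2)"
    by (simp only: complex_norm_square[symmetric] power_mult_distrib of_real_mult)
  finally have "(norm (c *\<^sub>C x))\<^sup>2 = (cmod c * norm x)\<^sup>2"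
    using of_real_eq_iff by blast
  then show ?thesis
    by simp
qed

lemma norm_add_square:
  "(norm (x + y))\<^sup>2 = (norm x)\<^sup>2 + 2 * Re (cinner x y) + (norm (y::'a::complex_inner))\<^sup>2"
proof -
  have "complex_of_real ((norm (x + y))\<^sup>2) = cinner x x + (cinner x y + cnj (cinner x y)) + cinner y y"
    by (metis (no_types, lifting) add.assoc cinner_add_left cinner_add_right cinner_commute cinner_self)
  then have "Re (complex_of_real ((norm (x + y))\<^sup>2)) = Re (cinner x x + (cinner x y + cnj (cinner x y)) + cinner y y)"
    by simp
  then show ?thesis by (simp add: cinner_self)
qed

lemma Re_cinner_le: "Re (cinner x y) \<le> norm x * norm (y::'a::complex_inner)"
proof -
  have "(norm (x + y))\<^sup>2 \<le> (norm x + norm y)\<^sup>2"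
    by (simp add: norm_triangle_ineq power_mono)
  then show ?thesis by (simp add: norm_add_square power2_sum)
qed

lemma parallelogram:
  "(norm (x + y))\<^sup>2 + (norm (x - y))\<^sup>2 = 2 * (norm x)\<^sup>2 + 2 * (norm (y::'a::complex_inner))\<^sup>2"
  using norm_add_square[of x y] norm_add_square[of x "-y"] by (simp add: cinner_minus_right)


section \<open>Bounded operators\<close>

instantiation blinfun :: (real_normed_vector, complex_inner) complex_vector
begin

lift_definition scaleC_blinfun :: "complex \<Rightarrow> 'a \<Rightarrow>\<^sub>L 'b \<Rightarrow> 'a \<Rightarrow>\<^sub>L 'b"
  is "\<lambda>c T x. c *\<^sub>C T x"
proof -
  fix c and T :: "'a \<Rightarrow> 'b"
  assume "bounded_linear T"
  then interpret bounded_linear T .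
  show "bounded_linear (\<lambda>x. c *\<^sub>C T x)"
  proof (rule bounded_linear_intro)
    fix x y and r :: real
    show "c *\<^sub>C T (x + y) = c *\<^sub>C T x + c *\<^sub>C T y"
      by (simp add: add scaleC_add_right)
    show "c *\<^sub>C T (r *\<^sub>R x) = r *\<^sub>R c *\<^sub>C T x"
      by (simp add: scaleR scaleR_eq_scaleC scaleC_scaleC mult.commute)
    show "norm (c *\<^sub>C T x) \<le> norm x * (onorm T * cmod c)"
      using mult_left_mono[OF onorm[OF \<open>bounded_linear T\<close>, of x], of "cmod c"]
      by (simp add: ac_simps)
  qed
qed

instance
  by standard (transfer; simp add: scaleC_add_right scaleC_add_left scaleC_scaleC scaleR_eq_scaleC)+

end

(* Elements of the type of bounded linear maps are only real-linear, hence the carrier set. *)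
definition bounded_ops :: "('h::complex_inner \<Rightarrow>\<^sub>L 'h) set" where
  "bounded_ops = {T :: 'h \<Rightarrow>\<^sub>L 'h. \<forall>c x. T (c *\<^sub>C x) = c *\<^sub>C T x}"

definition cadjoint :: "('h::chilbert_space \<Rightarrow>\<^sub>L 'h) \<Rightarrow> ('h \<Rightarrow>\<^sub>L 'h)" where
  "cadjoint T = (THE S. S \<in> bounded_ops \<and> (\<forall>x y. cinner (T x) y = cinner x (S y)))"

lemma cinner_eqI:
  assumes "\<And>x. cinner x y = cinner x z"
  shows "y = (z::'a::complex_inner)"
proof -
  have "cinner (y - z) (y - z) = 0"
    using assms by (simp add: cinner_diff_right)
  then show ?thesis by (simp add: cinner_self)
qed

lemma riesz_real:
  fixes f :: "'a::chilbert_space \<Rightarrow> real"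
  assumes f: "bounded_linear f"
  shows "\<exists>y. \<forall>x. f x = Re (cinner x y)"
proof -
  interpret f: bounded_linear f by fact
  define q where "q x = (norm x)\<^sup>2 - 2 * f x" for x
  define K where "K = onorm f"
  have low: "q x \<ge> - K\<^sup>2" for x
  proof -
    have "f x \<le> K * norm x" using onorm[OF f, of x] by (simp add: K_def abs_le_iff)
    moreover have "(norm x - K)\<^sup>2 \<ge> 0" by simp
    ultimately show ?thesis unfolding q_def by (simp add: power2_diff mult.commute)
  qed
  define m where "m = (INF x. q x)"
  have bdd: "bdd_below (range q)" unfolding bdd_below_def using low by blast
  have m_le: "m \<le> q x" for x unfolding m_def by (rule cINF_lower[OF bdd]) simp
  have "\<exists>x. q x < m + inverse (real (Suc n))" for n
  proof -
    have "(INF x. q x) < m + inverse (real (Suc n))" unfolding m_def by simp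
    then show ?thesis by (subst (asm) cINF_less_iff[OF _ bdd]) auto
  qed
  then obtain X where X: "\<And>n. q (X n) < m + inverse (real (Suc n))" by metis
  have par: "(norm (x - y))\<^sup>2 \<le> 2 * q x + 2 * q y - 4 * m" for x y
  proof -
    have "q ((1/2) *\<^sub>R (x + y)) = (norm (x + y))\<^sup>2 / 4 - f x - f y"
      unfolding q_def norm_scaleR power_mult_distrib by (simp add: f.scaleR f.add power_divide add_divide_distrib)
    with m_le[of "(1/2) *\<^sub>R (x + y)"] have "4 * m \<le> (norm (x + y))\<^sup>2 - 4 * f x - 4 * f y" by simp
    with parallelogram[of x y] show ?thesis unfolding q_def by simp
  qed
  have "Cauchy X"
  proof (rule metric_CauchyI)
    fix e :: real assume "e > 0"
    then obtain N where N: "inverse (real (Suc N)) < e\<^sup>2 / 4"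
      using reals_Archimedean[of "e\<^sup>2 / 4"] by auto
    have "dist (X a) (X b) < e" if "a \<ge> N" "b \<ge> N" for a b
    proof -
      have "inverse (real (Suc a)) \<le> inverse (real (Suc N))" "inverse (real (Suc b)) \<le> inverse (real (Suc N))"
        using that by (auto intro!: le_imp_inverse_le)
      then have "(norm (X a - X b))\<^sup>2 < e\<^sup>2"
        using par[of "X a" "X b"] X[of a] X[of b] N by linarith
      then show ?thesis using \<open>e > 0\<close> by (simp add: dist_norm power_less_imp_less_base)
    qed
    then show "\<exists>M. \<forall>a\<ge>M. \<forall>b\<ge>M. dist (X a) (X b) < e" by blast
  qed
  then obtain y where y: "X \<longlonglongrightarrow> y" using Cauchy_convergent convergent_def by blast
  have "(\<lambda>n. q (X n)) \<longlonglongrightarrow> q y"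
    unfolding q_def by (intro tendsto_intros y f.tendsto)
  moreover have "(\<lambda>n. m + inverse (real (Suc n))) \<longlonglongrightarrow> m"
    using LIMSEQ_inverse_real_of_nat_add[of m] by simp
  ultimately have qy: "q y \<le> m"
    by (rule LIMSEQ_le) (use X less_imp_le in blast)
  have "f x = Re (cinner x y)" for x
  proof -
    define d where "d = Re (cinner x y) - f x"
    have Re_commute: "Re (cinner y x) = Re (cinner x y)"
      by (metis cinner_commute cnj.sel(1))
    have ineq: "0 \<le> 2 * t * d + t\<^sup>2 * (norm x)\<^sup>2" for t :: real
    proof -
      have "q y \<le> q (y + t *\<^sub>R x)" using qy m_le order_trans by blast
      then show ?thesis
        unfolding q_def d_def
        by (simp add: norm_add_square cinner_scaleR_right f.add f.scaleR Re_commute algebra_simps)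
    qed
    have "d = 0"
    proof (rule ccontr)
      assume d: "d \<noteq> 0"
      define s where "s = (norm x)\<^sup>2 + 1"
      have s: "s > 0" "(norm x)\<^sup>2 < s" unfolding s_def by (simp_all add: add_nonneg_pos)
      have "0 \<le> 2 * (- d / s) * d + (- d / s)\<^sup>2 * (norm x)\<^sup>2" by (rule ineq)
      also have "\<dots> \<le> 2 * (- d / s) * d + (- d / s)\<^sup>2 * s"
        using s by (intro add_left_mono mult_left_mono) auto
      also have "\<dots> = - (d\<^sup>2 / s)" using s by (simp add: power2_eq_square field_simps)
      finally show False using d s by (simp add: divide_le_0_iff)
    qed
    then show ?thesis by (simp add: d_def)
  qed
  then show ?thesis by blast
qed

lemma cadjoint_exists:
  fixes T :: "'h::chilbert_space \<Rightarrow>\<^sub>L 'h"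
  assumes T: "T \<in> bounded_ops"
  shows "\<exists>!S. S \<in> bounded_ops \<and> (\<forall>x y. cinner (T x) y = cinner x (S y))"
proof -
  have "\<exists>z. \<forall>x. cinner (T x) y = cinner x z" for y
  proof -
    have "bounded_linear (\<lambda>x. Re (cinner (T x) y))"
    proof (rule bounded_linear_intro)
      fix a b and r :: real
      show "Re (cinner (T (a + b)) y) = Re (cinner (T a) y) + Re (cinner (T b) y)"
        by (simp add: blinfun.add_right cinner_add_left)
      show "Re (cinner (T (r *\<^sub>R a)) y) = r *\<^sub>R Re (cinner (T a) y)"
        by (simp add: blinfun.scaleR_right cinner_scaleR_left)
      have "\<bar>Re (cinner u y)\<bar> \<le> norm u * norm y" for u
        using Re_cinner_le[of u y] Re_cinner_le[of "-u" y] by (simp add: cinner_minus_left)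
      then show "norm (Re (cinner (T a) y)) \<le> norm a * (norm T * norm y)"
        by (smt (verit, best) mult.assoc mult.commute mult_right_mono norm_blinfun norm_ge_zero real_norm_def)
    qed
    from riesz_real[OF this] obtain z where z: "\<And>x. Re (cinner (T x) y) = Re (cinner x z)" by blast
    have "cinner (T x) y = cinner x z" for x
    proof (rule complex_eqI)
      show "Re (cinner (T x) y) = Re (cinner x z)" by (rule z)
      show "Im (cinner (T x) y) = Im (cinner x z)"
        using z[of "\<i> *\<^sub>C x"] T by (simp add: bounded_ops_def cinner_scaleC_left)
    qed
    then show ?thesis by blast
  qed
  then obtain S where S: "\<And>x y. cinner (T x) y = cinner x (S y)" by metis
  have add: "S (a + b) = S a + S b" for a b
    by (rule cinner_eqI) (simp add: S[symmetric] cinner_add_right)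
  have scaleC: "S (c *\<^sub>C a) = c *\<^sub>C S a" for a c
    by (rule cinner_eqI) (simp add: S[symmetric] cinner_scaleC_right)
  have bound: "norm (S a) \<le> norm a * norm T" for a
  proof (cases "S a = 0")
    case False
    have "(norm (S a))\<^sup>2 = Re (cinner (T (S a)) a)" by (simp add: S cinner_self)
    also have "\<dots> \<le> norm (T (S a)) * norm a" by (rule Re_cinner_le)
    also have "\<dots> \<le> (norm T * norm (S a)) * norm a"
      by (intro mult_right_mono norm_blinfun) auto
    finally show ?thesis using False by (simp add: power2_eq_square mult.commute mult.left_commute)
  qed simp
  have lin: "bounded_linear S"
    by (rule bounded_linear_intro[OF add _ bound]) (simp add: scaleR_eq_scaleC scaleC)
  have "Blinfun S \<in> bounded_ops \<and> (\<forall>x y. cinner (T x) y = cinner x (Blinfun S y))"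
    by (simp add: bounded_ops_def bounded_linear_Blinfun_apply[OF lin] scaleC S)
  then show ?thesis
  proof (rule ex1I)
    fix S' assume "S' \<in> bounded_ops \<and> (\<forall>x y. cinner (T x) y = cinner x (S' y))"
    then have "S' y = S y" for y by (intro cinner_eqI) (metis S)
    then show "S' = Blinfun S" by (intro blinfun_eqI) (simp add: bounded_linear_Blinfun_apply[OF lin])
  qed
qed

lemma cadjoint:
  assumes "T \<in> bounded_ops"
  shows "cadjoint T \<in> bounded_ops" "cinner (T x) y = cinner x (cadjoint T y)"
  using theI'[OF cadjoint_exists[OF assms], folded cadjoint_def] by auto


section \<open>Von Neumann algebras\<close>

definition commutant :: "('h::complex_inner \<Rightarrow>\<^sub>L 'h) set \<Rightarrow> ('h \<Rightarrow>\<^sub>L 'h) set" where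
  "commutant M = {T \<in> bounded_ops. \<forall>a\<in>M. T o\<^sub>L a = a o\<^sub>L T}"

(* Being a commutant, such a D is automatically a unital subalgebra (see below). *)
definition von_neumann_algebra :: "('h::chilbert_space \<Rightarrow>\<^sub>L 'h) set \<Rightarrow> bool" where
  "von_neumann_algebra D \<longleftrightarrow>
     D \<subseteq> bounded_ops \<and> (\<forall>a\<in>D. cadjoint a \<in> D) \<and> commutant (commutant D) = D"

lemma commutant_algebra:
  "id_blinfun \<in> commutant M"
  "a \<in> commutant M \<Longrightarrow> b \<in> commutant M \<Longrightarrow> a + b \<in> commutant M"
  "a \<in> commutant M \<Longrightarrow> b \<in> commutant M \<Longrightarrow> a o\<^sub>L b \<in> commutant M"
  "M \<subseteq> bounded_ops \<Longrightarrow> a \<in> commutant M \<Longrightarrow> c *\<^sub>C a \<in> commutant M"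
  by (auto simp: commutant_def bounded_ops_def blinfun_apply_inject[symmetric] fun_eq_iff blinfun.add_left blinfun.add_right
      scaleC_add_right scaleC_blinfun.rep_eq scaleC_scaleC mult.commute subset_iff)

lemma von_neumann_algebra_unital_subalgebra:
  assumes "von_neumann_algebra D"
  shows "id_blinfun \<in> D"
    and "a \<in> D \<Longrightarrow> b \<in> D \<Longrightarrow> a + b \<in> D"
    and "a \<in> D \<Longrightarrow> b \<in> D \<Longrightarrow> a o\<^sub>L b \<in> D"
    and "a \<in> D \<Longrightarrow> c *\<^sub>C a \<in> D"
proof -
  have D: "commutant (commutant D) = D" and c: "commutant D \<subseteq> bounded_ops"
    using assms by (auto simp: von_neumann_algebra_def commutant_def)
  show "id_blinfun \<in> D"
    "a \<in> D \<Longrightarrow> b \<in> D \<Longrightarrow> a + b \<in> D"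
    "a \<in> D \<Longrightarrow> b \<in> D \<Longrightarrow> a o\<^sub>L b \<in> D"
    "a \<in> D \<Longrightarrow> c *\<^sub>C a \<in> D"
    using commutant_algebra[where M = "commutant D", unfolded D] c by auto
qed

definition abelian :: "('h::complex_inner \<Rightarrow>\<^sub>L 'h) set \<Rightarrow> bool" where
  "abelian D \<longleftrightarrow> (\<forall>a\<in>D. \<forall>b\<in>D. a o\<^sub>L b = b o\<^sub>L a)"

definition projection :: "('h::chilbert_space \<Rightarrow>\<^sub>L 'h) \<Rightarrow> bool" where
  "projection p \<longleftrightarrow> p \<in> bounded_ops \<and> p o\<^sub>L p = p \<and> cadjoint p = p"

(* For projections, q \<le> p means p q = q. *)
definition minimal_projection :: "('h::chilbert_space \<Rightarrow>\<^sub>L 'h) set \<Rightarrow> ('h \<Rightarrow>\<^sub>L 'h) \<Rightarrow> bool" where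
  "minimal_projection D p \<longleftrightarrow>
     p \<in> D \<and> projection p \<and> p \<noteq> 0 \<and>
     (\<forall>q\<in>D. projection q \<and> p o\<^sub>L q = q \<longrightarrow> q = 0 \<or> q = p)"

definition diffuse :: "('h::chilbert_space \<Rightarrow>\<^sub>L 'h) set \<Rightarrow> bool" where
  "diffuse D \<longleftrightarrow> \<not> (\<exists>p. minimal_projection D p)"

definition star_hom ::
  "('h::chilbert_space \<Rightarrow>\<^sub>L 'h) set \<Rightarrow> ('k::chilbert_space \<Rightarrow>\<^sub>L 'k) set \<Rightarrow>
   (('h \<Rightarrow>\<^sub>L 'h) \<Rightarrow> ('k \<Rightarrow>\<^sub>L 'k)) \<Rightarrow> bool" where
  "star_hom D E \<phi> \<longleftrightarrow>
     (\<forall>a\<in>D. \<phi> a \<in> E) \<and>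
     (\<forall>a\<in>D. \<forall>b\<in>D. \<phi> (a + b) = \<phi> a + \<phi> b) \<and>
     (\<forall>c. \<forall>a\<in>D. \<phi> (c *\<^sub>C a) = c *\<^sub>C \<phi> a) \<and>
     (\<forall>a\<in>D. \<forall>b\<in>D. \<phi> (a o\<^sub>L b) = \<phi> a o\<^sub>L \<phi> b) \<and>
     (\<forall>a\<in>D. \<phi> (cadjoint a) = cadjoint (\<phi> a))"


section \<open>The Hilbert space of square-summable functions\<close>

typedef 'a ell2 = "{f :: 'a \<Rightarrow> complex. (\<lambda>x. (cmod (f x))\<^sup>2) summable_on UNIV}"
  morphisms ell2_apply Abs_ell2
  by (rule exI[of _ "\<lambda>_. 0"]) simp

setup_lifting type_definition_ell2

lemma sq_summable_bound:
  fixes f :: "'a \<Rightarrow> complex"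
  assumes "\<And>F. finite F \<Longrightarrow> L2_set (\<lambda>x. cmod (f x)) F \<le> C"
  shows "(\<lambda>x. (cmod (f x))\<^sup>2) summable_on UNIV"
    and "sqrt (\<Sum>\<^sub>\<infinity>x. (cmod (f x))\<^sup>2) \<le> C"
proof -
  have C: "0 \<le> C" using assms[of "{}"] by simp
  have le: "(\<Sum>x\<in>F. (cmod (f x))\<^sup>2) \<le> C\<^sup>2" if "finite F" for F
    using assms[OF that] unfolding L2_set_def by (simp add: sqrt_le_D)
  show s: "(\<lambda>x. (cmod (f x))\<^sup>2) summable_on UNIV"
    by (rule nonneg_bdd_above_summable_on) (auto intro: bdd_aboveI2[OF le])
  have "(\<Sum>\<^sub>\<infinity>x. (cmod (f x))\<^sup>2) \<le> C\<^sup>2"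
    by (rule infsum_le_finite_sums[OF s]) (use le in auto)
  then show "sqrt (\<Sum>\<^sub>\<infinity>x. (cmod (f x))\<^sup>2) \<le> C"
    using C by (simp add: real_le_lsqrt)
qed

lemma L2_set_le_sq_sum:
  fixes f :: "'a \<Rightarrow> complex"
  assumes "(\<lambda>x. (cmod (f x))\<^sup>2) summable_on UNIV" "finite F"
  shows "L2_set (\<lambda>x. cmod (f x)) F \<le> sqrt (\<Sum>\<^sub>\<infinity>x. (cmod (f x))\<^sup>2)"
  unfolding L2_set_def by (simp add: finite_sum_le_infsum assms)

lemma sq_sum_add:
  fixes f g :: "'a \<Rightarrow> complex"
  assumes f: "(\<lambda>x. (cmod (f x))\<^sup>2) summable_on UNIV" and g: "(\<lambda>x. (cmod (g x))\<^sup>2) summable_on UNIV"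
  shows "(\<lambda>x. (cmod (f x + g x))\<^sup>2) summable_on UNIV"
    and "sqrt (\<Sum>\<^sub>\<infinity>x. (cmod (f x + g x))\<^sup>2) \<le>
      sqrt (\<Sum>\<^sub>\<infinity>x. (cmod (f x))\<^sup>2) + sqrt (\<Sum>\<^sub>\<infinity>x. (cmod (g x))\<^sup>2)"
proof -
  have le: "L2_set (\<lambda>x. cmod (f x + g x)) F \<le>
      sqrt (\<Sum>\<^sub>\<infinity>x. (cmod (f x))\<^sup>2) + sqrt (\<Sum>\<^sub>\<infinity>x. (cmod (g x))\<^sup>2)" if "finite F" for F
  proof -
    have "L2_set (\<lambda>x. cmod (f x + g x)) F \<le> L2_set (\<lambda>x. cmod (f x) + cmod (g x)) F"
      by (rule L2_set_mono) (auto simp: norm_triangle_ineq)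
    also have "\<dots> \<le> L2_set (\<lambda>x. cmod (f x)) F + L2_set (\<lambda>x. cmod (g x)) F"
      by (rule L2_set_triangle_ineq)
    also have "\<dots> \<le> sqrt (\<Sum>\<^sub>\<infinity>x. (cmod (f x))\<^sup>2) + sqrt (\<Sum>\<^sub>\<infinity>x. (cmod (g x))\<^sup>2)"
      by (intro add_mono L2_set_le_sq_sum f g that)
    finally show ?thesis .
  qed
  show "(\<lambda>x. (cmod (f x + g x))\<^sup>2) summable_on UNIV"
    and "sqrt (\<Sum>\<^sub>\<infinity>x. (cmod (f x + g x))\<^sup>2) \<le>
      sqrt (\<Sum>\<^sub>\<infinity>x. (cmod (f x))\<^sup>2) + sqrt (\<Sum>\<^sub>\<infinity>x. (cmod (g x))\<^sup>2)"
    using sq_summable_bound[of "\<lambda>x. f x + g x", OF le] by auto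
qed

lemma sq_sum_cmult:
  fixes f :: "'a \<Rightarrow> complex"
  assumes f: "(\<lambda>x. (cmod (f x))\<^sup>2) summable_on UNIV"
  shows "(\<lambda>x. (cmod (c * f x))\<^sup>2) summable_on UNIV"
    and "sqrt (\<Sum>\<^sub>\<infinity>x. (cmod (c * f x))\<^sup>2) = cmod c * sqrt (\<Sum>\<^sub>\<infinity>x. (cmod (f x))\<^sup>2)"
  by (simp_all add: norm_mult power_mult_distrib summable_on_cmult_right f infsum_cmult_right'
      real_sqrt_mult)

lemma cinner_summable:
  fixes f g :: "'a \<Rightarrow> complex"
  assumes "(\<lambda>x. (cmod (f x))\<^sup>2) summable_on UNIV" "(\<lambda>x. (cmod (g x))\<^sup>2) summable_on UNIV"
  shows "(\<lambda>x. f x * cnj (g x)) summable_on UNIV"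
proof (rule abs_summable_summable, rule abs_summable_product)
  show "(\<lambda>x. cmod (f x * f x)) summable_on UNIV" "(\<lambda>x. cmod (cnj (g x) * cnj (g x))) summable_on UNIV"
    using assms by (simp_all add: norm_mult power2_eq_square)
qed

instantiation ell2 :: (type) complex_vector
begin

lift_definition zero_ell2 :: "'a ell2" is "\<lambda>_. 0" by simp
lift_definition plus_ell2 :: "'a ell2 \<Rightarrow> 'a ell2 \<Rightarrow> 'a ell2" is "\<lambda>f g x. f x + g x"
  by (rule sq_sum_add)
lift_definition minus_ell2 :: "'a ell2 \<Rightarrow> 'a ell2 \<Rightarrow> 'a ell2" is "\<lambda>f g x. f x - g x"
  using sq_sum_add(1)[of _ "\<lambda>x. - _ x"] by simp
lift_definition uminus_ell2 :: "'a ell2 \<Rightarrow> 'a ell2" is "\<lambda>f x. - f x" by simp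
lift_definition scaleC_ell2 :: "complex \<Rightarrow> 'a ell2 \<Rightarrow> 'a ell2" is "\<lambda>c f x. c * f x"
  by (rule sq_sum_cmult)
definition scaleR_ell2 :: "real \<Rightarrow> 'a ell2 \<Rightarrow> 'a ell2" where
  "scaleR_ell2 r f = complex_of_real r *\<^sub>C f"

instance
proof
  fix f g h :: "'a ell2" and c d :: complex and r s :: real
  show "f + g + h = f + (g + h)" by transfer (simp add: add.assoc)
  show "f + g = g + f" by transfer (simp add: add.commute)
  show "0 + f = f" by transfer simp
  show "- f + f = 0" by transfer simp
  show "f - g = f + - g" by transfer simp
  show "r *\<^sub>R (f + g) = r *\<^sub>R f + r *\<^sub>R g"
    unfolding scaleR_ell2_def by transfer (simp add: distrib_left)
  show "(r + s) *\<^sub>R f = r *\<^sub>R f + s *\<^sub>R f"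
    unfolding scaleR_ell2_def by transfer (simp add: distrib_right)
  show "r *\<^sub>R s *\<^sub>R f = (r * s) *\<^sub>R f"
    unfolding scaleR_ell2_def by transfer (simp add: mult.assoc)
  show "1 *\<^sub>R f = f" unfolding scaleR_ell2_def by transfer simp
  show "c *\<^sub>C (f + g) = c *\<^sub>C f + c *\<^sub>C g" by transfer (simp add: distrib_left)
  show "(c + d) *\<^sub>C f = c *\<^sub>C f + d *\<^sub>C f" by transfer (simp add: distrib_right)
  show "c *\<^sub>C d *\<^sub>C f = (c * d) *\<^sub>C f" by transfer (simp add: mult.assoc)
  show "r *\<^sub>R f = complex_of_real r *\<^sub>C f" by (rule scaleR_ell2_def)
qed

end

instantiation ell2 :: (type) complex_inner
begin

lift_definition cinner_ell2 :: "'a ell2 \<Rightarrow> 'a ell2 \<Rightarrow> complex"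
  is "\<lambda>f g. \<Sum>\<^sub>\<infinity>x. f x * cnj (g x)" .
lift_definition norm_ell2 :: "'a ell2 \<Rightarrow> real" is "\<lambda>f. sqrt (\<Sum>\<^sub>\<infinity>x. (cmod (f x))\<^sup>2)" .

definition sgn_ell2 :: "'a ell2 \<Rightarrow> 'a ell2" where "sgn_ell2 f = f /\<^sub>R norm f"
definition dist_ell2 :: "'a ell2 \<Rightarrow> 'a ell2 \<Rightarrow> real" where "dist_ell2 f g = norm (f - g)"
definition uniformity_ell2 :: "('a ell2 \<times> 'a ell2) filter" where
  "uniformity_ell2 = (INF e\<in>{0 <..}. principal {(x, y). dist x y < e})"
definition open_ell2 :: "'a ell2 set \<Rightarrow> bool" where
  "open_ell2 U = (\<forall>x\<in>U. \<forall>\<^sub>F (x', y) in uniformity. x' = x \<longrightarrow> y \<in> U)"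

instance
proof
  fix f g h :: "'a ell2" and c :: complex and r :: real and U :: "'a ell2 set"
  show "sgn f = f /\<^sub>R norm f" by (rule sgn_ell2_def)
  show "dist f g = norm (f - g)" by (rule dist_ell2_def)
  show "uniformity = (INF e\<in>{0 <..}. principal {(x, y). dist x (y::'a ell2) < e})"
    by (rule uniformity_ell2_def)
  show "open U = (\<forall>x\<in>U. \<forall>\<^sub>F (x', y) in uniformity. x' = x \<longrightarrow> y \<in> U)"
    by (rule open_ell2_def)
  show "(norm f = 0) = (f = 0)"
  proof transfer
    fix f :: "'a \<Rightarrow> complex" assume f: "(\<lambda>x. (cmod (f x))\<^sup>2) summable_on UNIV"
    have "f x = 0" if "(\<Sum>\<^sub>\<infinity>x. (cmod (f x))\<^sup>2) = 0" for x
      using nonneg_infsum_le_0D[of "\<lambda>x. (cmod (f x))\<^sup>2" UNIV x] f that by simp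
    then have "(\<Sum>\<^sub>\<infinity>x. (cmod (f x))\<^sup>2) = 0 \<Longrightarrow> f = (\<lambda>_. 0)" by blast
    moreover have "f = (\<lambda>_. 0) \<Longrightarrow> (\<Sum>\<^sub>\<infinity>x. (cmod (f x))\<^sup>2) = 0" by simp
    ultimately show "(sqrt (\<Sum>\<^sub>\<infinity>x. (cmod (f x))\<^sup>2) = 0) = (f = (\<lambda>_. 0))"
      unfolding real_sqrt_eq_0_iff by (rule iffI)
  qed
  show "norm (f + g) \<le> norm f + norm g" by transfer (rule sq_sum_add)
  show "norm (r *\<^sub>R f) = \<bar>r\<bar> * norm f"
    unfolding scaleR_ell2_def by transfer (simp add: sq_sum_cmult)
  show "cinner f g = cnj (cinner g f)"
    by transfer (subst infsum_cnj[symmetric], simp add: mult.commute)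
  show "cinner (f + g) h = cinner f h + cinner g h"
    by transfer (simp add: distrib_right infsum_add cinner_summable)
  show "cinner (c *\<^sub>C f) g = c * cinner f g"
    by transfer (simp add: mult.assoc infsum_cmult_right')
  show "cinner f f = complex_of_real ((norm f)\<^sup>2)"
  proof transfer
    fix f :: "'a \<Rightarrow> complex" assume f: "(\<lambda>x. (cmod (f x))\<^sup>2) summable_on UNIV"
    have "(\<Sum>\<^sub>\<infinity>x. f x * cnj (f x)) = (\<Sum>\<^sub>\<infinity>x. complex_of_real ((cmod (f x))\<^sup>2))"
      by (simp only: complex_norm_square)
    also have "\<dots> = complex_of_real (\<Sum>\<^sub>\<infinity>x. (cmod (f x))\<^sup>2)"
      using f by (intro infsumI) (simp only: has_sum_of_real_iff has_sum_infsum)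
    finally show "(\<Sum>\<^sub>\<infinity>x. f x * cnj (f x)) = complex_of_real ((sqrt (\<Sum>\<^sub>\<infinity>x. (cmod (f x))\<^sup>2))\<^sup>2)"
      by (simp only: real_sqrt_pow2 infsum_nonneg zero_le_power2)
  qed
qed

end

lemma norm_ell2_apply_le: "cmod (ell2_apply f x) \<le> norm f"
  using L2_set_le_sq_sum[of "ell2_apply f" "{x}"] ell2_apply[of f] by (simp add: norm_ell2.rep_eq)

instance ell2 :: (type) chilbert_space
proof
  fix X :: "nat \<Rightarrow> 'a ell2"
  assume X: "Cauchy X"
  have "Cauchy (\<lambda>n. ell2_apply (X n) x)" for x
  proof (rule metric_CauchyI)
    fix e :: real assume "e > 0"
    then obtain M where M: "\<And>m n. m \<ge> M \<Longrightarrow> n \<ge> M \<Longrightarrow> dist (X m) (X n) < e"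
      using metric_CauchyD[OF X] by blast
    have "dist (ell2_apply (X m) x) (ell2_apply (X n) x) \<le> dist (X m) (X n)" for m n
      using norm_ell2_apply_le[of "X m - X n" x] by (simp add: dist_norm minus_ell2.rep_eq)
    then show "\<exists>M. \<forall>m\<ge>M. \<forall>n\<ge>M. dist (ell2_apply (X m) x) (ell2_apply (X n) x) < e"
      using M le_less_trans by blast
  qed
  then have "\<exists>l. (\<lambda>n. ell2_apply (X n) x) \<longlonglongrightarrow> l" for x
    using Cauchy_convergent convergent_def by blast
  then obtain l where l: "\<And>x. (\<lambda>n. ell2_apply (X n) x) \<longlonglongrightarrow> l x" by metis
  have L: "L2_set (\<lambda>x. cmod (ell2_apply (X n) x - l x)) F \<le> e"
    if F: "finite F" and M: "\<And>m. m \<ge> M \<Longrightarrow> dist (X n) (X m) \<le> e" for n M F e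
  proof (rule LIMSEQ_le_const2)
    show "(\<lambda>m. L2_set (\<lambda>x. cmod (ell2_apply (X n) x - ell2_apply (X m) x)) F) \<longlonglongrightarrow>
      L2_set (\<lambda>x. cmod (ell2_apply (X n) x - l x)) F"
      unfolding L2_set_def by (intro tendsto_intros l)
    have "L2_set (\<lambda>x. cmod (ell2_apply (X n) x - ell2_apply (X m) x)) F \<le> dist (X n) (X m)" for m
      using L2_set_le_sq_sum[of "ell2_apply (X n - X m)" F] ell2_apply[of "X n - X m"] F
      by (simp add: dist_norm norm_ell2.rep_eq minus_ell2.rep_eq)
    then show "\<exists>N. \<forall>m\<ge>N. L2_set (\<lambda>x. cmod (ell2_apply (X n) x - ell2_apply (X m) x)) F \<le> e"
      using M order_trans by blast
  qed
  have cauchy: "\<exists>M. \<forall>n\<ge>M. \<forall>m\<ge>M. dist (X n) (X m) \<le> e" if "e > 0" for e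
    using metric_CauchyD[OF X that] less_imp_le by blast
  obtain M where M: "\<And>n m. n \<ge> M \<Longrightarrow> m \<ge> M \<Longrightarrow> dist (X n) (X m) \<le> 1"
    using cauchy[of 1] by auto
  have "(\<lambda>x. (cmod (ell2_apply (X M) x - l x))\<^sup>2) summable_on UNIV"
    by (rule sq_summable_bound) (rule L, assumption, rule M, auto)
  then have "(\<lambda>x. (cmod (ell2_apply (X M) x + - (ell2_apply (X M) x - l x)))\<^sup>2) summable_on UNIV"
    using ell2_apply[of "X M"] by (intro sq_sum_add) (auto simp: norm_minus_commute)
  then have lsum: "(\<lambda>x. (cmod (l x))\<^sup>2) summable_on UNIV" by simp
  have app: "ell2_apply (Abs_ell2 l) = l" by (rule Abs_ell2_inverse) (simp add: lsum)
  have "X \<longlonglongrightarrow> Abs_ell2 l"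
  proof (rule metric_LIMSEQ_I)
    fix e :: real assume "e > 0"
    then obtain M where M: "\<And>n m. n \<ge> M \<Longrightarrow> m \<ge> M \<Longrightarrow> dist (X n) (X m) \<le> e / 2"
      using cauchy[of "e/2"] by auto
    have "dist (X n) (Abs_ell2 l) \<le> e / 2" if "n \<ge> M" for n
      unfolding dist_norm norm_ell2.rep_eq minus_ell2.rep_eq app
      by (rule sq_summable_bound) (rule L, assumption, rule M[OF that])
    then show "\<exists>N. \<forall>n\<ge>N. dist (X n) (Abs_ell2 l) < e"
      using \<open>e > 0\<close> by (intro exI[of _ M]) (smt (verit) field_sum_of_halves)
  qed
  then show "convergent X" by (auto simp: convergent_def)
qed


section \<open>The quasi-local algebra\<close>

definition uniformly_locally_finite :: "'x::metric_space itself \<Rightarrow> bool" where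
  "uniformly_locally_finite _ \<longleftrightarrow>
     (\<forall>r>0. \<exists>N. \<forall>x::'x. finite (cball x r) \<and> card (cball x r) \<le> N)"

lift_definition restrict_ell2 :: "'x set \<Rightarrow> 'x ell2 \<Rightarrow> 'x ell2"
  is "\<lambda>A f x. if x \<in> A then f x else 0"
  by (rule summable_on_comparison_test) auto

lift_definition chi :: "'x set \<Rightarrow> 'x ell2 \<Rightarrow>\<^sub>L 'x ell2" is restrict_ell2
proof (rule bounded_linear_intro)
  fix A and f g :: "'x ell2" and r :: real
  show "restrict_ell2 A (f + g) = restrict_ell2 A f + restrict_ell2 A g" by transfer auto
  show "restrict_ell2 A (r *\<^sub>R f) = r *\<^sub>R restrict_ell2 A f"
    unfolding scaleR_ell2_def by transfer auto
  have "norm (restrict_ell2 A f) \<le> norm f"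
  proof transfer
    fix A :: "'x set" and f :: "'x \<Rightarrow> complex"
    assume f: "(\<lambda>x. (cmod (f x))\<^sup>2) summable_on UNIV"
    then have "(\<lambda>x. (cmod (if x \<in> A then f x else 0))\<^sup>2) summable_on UNIV"
      by (rule summable_on_comparison_test) auto
    from infsum_mono[OF this f]
    show "sqrt (\<Sum>\<^sub>\<infinity>x. (cmod (if x \<in> A then f x else 0))\<^sup>2) \<le> sqrt (\<Sum>\<^sub>\<infinity>x. (cmod (f x))\<^sup>2)"
      by simp
  qed
  then show "norm (restrict_ell2 A f) \<le> norm f * 1" by simp
qed

(* setdist is 0, not \<infinity>, if A or B is empty; this is harmless as then chi A o a o chi B = 0. *)
definition quasi_local_algebra :: "('x::metric_space ell2 \<Rightarrow>\<^sub>L 'x ell2) set" where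
  "quasi_local_algebra =
     {a \<in> bounded_ops. \<forall>\<epsilon>>0. \<exists>r>0. \<forall>A B. setdist A B > r \<longrightarrow> norm (chi A o\<^sub>L a o\<^sub>L chi B) \<le> \<epsilon>}"

end

theory Submission
  imports Defs
begin

text \<open>Let \<open>\<phi>\<close> be an embedding of \<open>D\<close>. A gliding hump argument gives a nonzero projection \<open>q\<close> and an
  \<open>r\<close> such that \<open>\<phi> p\<close> is \<open>1/8\<close>-quasi-local at scale \<open>r\<close> for all projections \<open>p \<le> q\<close> of \<open>D\<close>. For a finite
  set \<open>B\<close>, all the \<open>\<phi> p\<close> then map \<open>\<ell>\<^sub>2(B)\<close> close to one finite-dimensional space, so that, up to
  half of the norm, \<open>\<phi> q\<close> is carried on \<open>\<ell>\<^sub>2(B)\<close> by boundedly many pieces of any partition of \<open>q\<close>. As \<open>D\<close> is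
  diffuse, the pieces can be taken arbitrarily small in a vector state \<open>\<zeta>\<close>. Removing from \<open>q\<close> such
  pieces for a sequence of balls \<open>B\<close> exhausting the space leaves a projection \<open>s \<noteq> 0\<close> with
  \<open>\<parallel>\<phi> s \<xi>\<parallel> \<le> \<parallel>\<xi>\<parallel>/2\<close> for all \<open>\<xi>\<close>, that is, \<open>\<phi> s = 0\<close>. This is the argument by which the measure
  algebra is not \<open>\<sigma>\<close>-centered; it does not need \<open>\<phi>\<close> to be normal.\<close>

section \<open>Projections in Hilbert space\<close>

text \<open>Makes the comparison test for vector-valued series available; the limit vector of the
  final argument is given by such a series.\<close>

instance chilbert_space \<subseteq> banach ..

lemma cinner_zero [simp]: "cinner 0 x = 0" "cinner x 0 = (0::complex)"
  for x :: "'a::complex_inner"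
  using cinner_diff_left[of x x x] cinner_diff_right[of x x x] by simp_all

lemma scaleC_zero_right [simp]: "c *\<^sub>C (0::'a::complex_inner) = 0"
  by (metis mult_zero_right norm_eq_zero norm_scaleC norm_zero)

lemma scaleC_diff_right: "c *\<^sub>C (x - y) = c *\<^sub>C x - c *\<^sub>C (y::'a::complex_inner)"
  by (metis add_diff_cancel_right' diff_add_cancel scaleC_add_right)

lemma cinner_zero_commute: "cinner x y = 0 \<longleftrightarrow> cinner y (x::'a::complex_inner) = 0"
  by (metis cinner_commute complex_cnj_zero)

text \<open>Cauchy-Schwarz: multiplying \<open>x\<close> by a unimodular scalar makes the inner
  product real and nonnegative, so the bound for real parts applies.\<close>

lemma cmod_cinner_le: "cmod (cinner x y) \<le> norm x * norm (y::'a::complex_inner)"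
proof (cases "cinner x y = 0")
  case False
  define c where "c = cnj (cinner x y) / cmod (cinner x y)"
  have "cinner (c *\<^sub>C x) y = complex_of_real (cmod (cinner x y))"
    using False complex_norm_square[of "cinner x y"]
    by (simp add: c_def cinner_scaleC_left power2_eq_square field_simps)
  then have "cmod (cinner x y) = Re (cinner (c *\<^sub>C x) y)" by simp
  also have "\<dots> \<le> norm (c *\<^sub>C x) * norm y" by (rule Re_cinner_le)
  also have "\<dots> = norm x * norm y"
    using False by (simp add: c_def norm_divide)
  finally show ?thesis .
qed simp

text \<open>A sequence in \<open>K\<close> minimizing the distance to \<open>x\<close> is Cauchy by
  the parallelogram law. Varying its limit inside \<open>K\<close> gives orthogonality of real
  parts, and replacing \<open>k\<close> by \<open>\<i> *\<^sub>C k\<close> handles imaginary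
  parts.\<close>

lemma orthogonal_decomposition:
  fixes K :: "'a::chilbert_space set"
  assumes "closed K" and zero: "0 \<in> K" and add: "\<And>x y. x \<in> K \<Longrightarrow> y \<in> K \<Longrightarrow> x + y \<in> K"
    and scaleC: "\<And>c x. x \<in> K \<Longrightarrow> c *\<^sub>C x \<in> K"
  shows "\<exists>y\<in>K. \<forall>k\<in>K. cinner (x - y) k = 0"
proof -
  have scaleR: "r *\<^sub>R k \<in> K" if "k \<in> K" for r k
    using scaleC[OF that] by (simp add: scaleR_eq_scaleC)
  define q where "q y = (norm (x - y))\<^sup>2" for y
  define m where "m = (INF y\<in>K. q y)"
  have bdd: "bdd_below (q ` K)" unfolding q_def by (rule bdd_belowI2[of _ 0]) simp
  have m_le: "m \<le> q y" if "y \<in> K" for y unfolding m_def by (rule cINF_lower[OF bdd that])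
  have "\<exists>y\<in>K. q y < m + inverse (real (Suc n))" for n
  proof -
    have "(INF y\<in>K. q y) < m + inverse (real (Suc n))" unfolding m_def by simp
    then show ?thesis using zero by (subst (asm) cINF_less_iff[OF _ bdd]) auto
  qed
  then obtain X where XK: "\<And>n. X n \<in> K" and X: "\<And>n. q (X n) < m + inverse (real (Suc n))" by metis
  have par: "(norm (y - z))\<^sup>2 \<le> 2 * q y + 2 * q z - 4 * m" if "y \<in> K" "z \<in> K" for y z
  proof -
    have "(x - y) + (x - z) = 2 *\<^sub>R (x - (1/2) *\<^sub>R (y + z))"
      by (simp add: algebra_simps scaleR_2)
    then have "(norm ((x - y) + (x - z)))\<^sup>2 = 4 * q ((1/2) *\<^sub>R (y + z))"
      unfolding q_def by (simp add: power_mult_distrib)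
    moreover have "m \<le> q ((1/2) *\<^sub>R (y + z))" using m_le that add scaleR by blast
    moreover have "norm ((x - y) - (x - z)) = norm (y - z)" by (simp add: norm_minus_commute)
    ultimately show ?thesis using parallelogram[of "x - y" "x - z"] unfolding q_def by simp
  qed
  have "Cauchy X"
  proof (rule metric_CauchyI)
    fix e :: real assume "e > 0"
    then obtain N where N: "inverse (real (Suc N)) < e\<^sup>2 / 4"
      using reals_Archimedean[of "e\<^sup>2 / 4"] by auto
    have "dist (X a) (X b) < e" if "a \<ge> N" "b \<ge> N" for a b
    proof -
      have "inverse (real (Suc a)) \<le> inverse (real (Suc N))" "inverse (real (Suc b)) \<le> inverse (real (Suc N))"
        using that by (auto intro!: le_imp_inverse_le)
      then have "(norm (X a - X b))\<^sup>2 < e\<^sup>2"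
        using par[OF XK XK, of a b] X[of a] X[of b] N by linarith
      then show ?thesis using \<open>e > 0\<close> by (simp add: dist_norm power_less_imp_less_base)
    qed
    then show "\<exists>M. \<forall>a\<ge>M. \<forall>b\<ge>M. dist (X a) (X b) < e" by blast
  qed
  then obtain y where y: "X \<longlonglongrightarrow> y" using Cauchy_convergent convergent_def by blast
  have yK: "y \<in> K" using closed_sequentially[OF \<open>closed K\<close> _ y] XK by blast
  have "(\<lambda>n. q (X n)) \<longlonglongrightarrow> q y" unfolding q_def by (intro tendsto_intros y)
  moreover have "(\<lambda>n. m + inverse (real (Suc n))) \<longlonglongrightarrow> m"
    using LIMSEQ_inverse_real_of_nat_add[of m] by simp
  ultimately have qy: "q y \<le> m"
    by (rule LIMSEQ_le) (use X less_imp_le in blast)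
  have Re0: "Re (cinner (x - y) k) = 0" if k: "k \<in> K" for k
  proof (rule ccontr)
    define d where "d = Re (cinner (x - y) k)"
    assume "Re (cinner (x - y) k) \<noteq> 0"
    then have d: "d \<noteq> 0" by (simp add: d_def)
    \<comment> \<open>The best variation along \<open>k\<close> has coefficient \<open>d\<close>
      over the squared norm of \<open>k\<close>; the added 1 keeps the denominator positive.\<close>
    define s where "s = (norm k)\<^sup>2 + 1"
    have s: "s > 0" "(norm k)\<^sup>2 < s" unfolding s_def by (simp_all add: add_nonneg_pos)
    have "q y \<le> q (y + (d / s) *\<^sub>R k)"
      by (rule order_trans[OF qy m_le]) (intro add yK scaleR k)
    also have "\<dots> = (norm ((x - y) + (- (d / s)) *\<^sub>R k))\<^sup>2" by (simp add: q_def algebra_simps)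
    also have "\<dots> = q y - 2 * (d / s) * d + (d / s)\<^sup>2 * (norm k)\<^sup>2"
      unfolding norm_add_square cinner_scaleR_right by (simp add: q_def d_def power_mult_distrib power_divide)
    finally have "0 \<le> - 2 * (d / s) * d + (d / s)\<^sup>2 * (norm k)\<^sup>2" by simp
    also have "\<dots> \<le> - 2 * (d / s) * d + (d / s)\<^sup>2 * s"
      using s by (intro add_left_mono mult_left_mono) auto
    also have "\<dots> = - (d\<^sup>2 / s)" using s by (simp add: power2_eq_square field_simps)
    finally show False using d s by (simp add: divide_le_0_iff)
  qed
  have "cinner (x - y) k = 0" if "k \<in> K" for k
    using Re0[OF that] Re0[OF scaleC[OF that, of \<i>]] by (simp add: cinner_scaleC_right complex_eq_iff)
  then show ?thesis using yK by blast
qed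

section \<open>Projections as self-adjoint idempotents\<close>

lemma cadjoint_eqI:
  fixes T :: "'h::chilbert_space \<Rightarrow>\<^sub>L 'h"
  assumes "S \<in> bounded_ops" "T \<in> bounded_ops" "\<And>x y. cinner (T x) y = cinner x (S y)"
  shows "cadjoint T = S"
  using cadjoint_exists[OF assms(2)] cadjoint[OF assms(2)] assms by blast

text \<open>Replaces operator identities and the adjoint by pointwise equations, the form in which
  projections are handled below.\<close>

lemma projection_iff:
  "projection p \<longleftrightarrow> p \<in> bounded_ops \<and> (\<forall>x. p (p x) = p x) \<and> (\<forall>x y. cinner (p x) y = cinner x (p y))"
  unfolding projection_def
  by (metis blinfun_apply_blinfun_compose blinfun_eqI cadjoint(2) cadjoint_eqI)

lemma bounded_ops_simps:
  fixes a b :: "'h::complex_inner \<Rightarrow>\<^sub>L 'h"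
  assumes "a \<in> bounded_ops" "b \<in> bounded_ops"
  shows "a + b \<in> bounded_ops" "a - b \<in> bounded_ops" "a o\<^sub>L b \<in> bounded_ops"
  using assms by (auto simp: bounded_ops_def blinfun.bilinear_simps scaleC_add_right scaleC_diff_right)

lemma projection_0 [simp]: "projection 0" and projection_id [simp]: "projection id_blinfun"
  by (simp_all add: projection_iff bounded_ops_def)

lemma projection_compl: "projection p \<Longrightarrow> projection (id_blinfun - p)"
  using bounded_ops_simps(2)[of id_blinfun p]
  by (auto simp: projection_iff blinfun.bilinear_simps cinner_diff_left cinner_diff_right bounded_ops_def)

lemma projection_compose:
  assumes "projection p" "projection q" "p o\<^sub>L q = q o\<^sub>L p"
  shows "projection (p o\<^sub>L q)"
proof -
  have "p (q x) = q (p x)" for x using assms(3) by (metis blinfun_apply_blinfun_compose)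
  then show ?thesis
    using assms(1,2) bounded_ops_simps(3)[of p q] by (simp add: projection_iff)
qed

lemma projection_add:
  assumes "projection p" "projection q" "p o\<^sub>L q = 0"
  shows "projection (p + q)"
proof -
  have pq: "p (q x) = 0" for x using assms(3) by (metis blinfun_apply_blinfun_compose zero_blinfun.rep_eq)
  \<comment> \<open>Orthogonality is assumed in one order only; self-adjointness turns
    \<open>q (p x)\<close> into \<open>p (q y)\<close> on the other side of the inner
    product.\<close>
  have "cinner y (q (p x)) = 0" for x y
    using assms(1,2) pq by (metis projection_iff cinner_zero(1))
  then have "q (p x) = 0" for x using cinner_eqI[of "q (p x)" 0] by simp
  with pq show ?thesis
    using assms(1,2) bounded_ops_simps(1)[of p q]
    by (simp add: projection_iff blinfun.bilinear_simps cinner_add_left cinner_add_right)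
qed

lemma projection_pythagoras:
  assumes "projection p"
  shows "(norm x)\<^sup>2 = (norm (p x))\<^sup>2 + (norm (x - p x))\<^sup>2"
proof -
  have "cinner (p x) (x - p x) = 0"
    using assms by (simp add: projection_iff blinfun.diff_right)
  then show ?thesis using norm_add_square[of "p x" "x - p x"] by simp
qed

lemma projection_norm_le: "projection p \<Longrightarrow> norm (p x) \<le> norm x"
  using projection_pythagoras[of p x] by (simp add: power2_le_imp_le)

lemma projection_norm_le_1: "projection p \<Longrightarrow> norm p \<le> 1"
  by (rule norm_blinfun_bound) (auto simp: projection_norm_le)

text \<open>The component in \<open>K\<close> is determined by the orthogonality of the remainder
  (\<open>uniq\<close>); linearity, idempotence and self-adjointness all follow from this
  characterization.\<close>

lemma projection_exists:
  fixes K :: "'a::chilbert_space set"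
  assumes "closed K" "0 \<in> K" "\<And>x y. x \<in> K \<Longrightarrow> y \<in> K \<Longrightarrow> x + y \<in> K"
    and scaleC: "\<And>c x. x \<in> K \<Longrightarrow> c *\<^sub>C x \<in> K"
  shows "\<exists>p. projection p \<and> (\<forall>x. p x = x \<longleftrightarrow> x \<in> K)"
proof -
  have "\<forall>x. \<exists>y\<in>K. \<forall>k\<in>K. cinner (x - y) k = 0"
    using orthogonal_decomposition[OF assms] by blast
  then obtain f where fK: "\<And>x. f x \<in> K" and f: "\<And>x k. k \<in> K \<Longrightarrow> cinner (x - f x) k = 0"
    by metis
  have diffK: "x - y \<in> K" if "x \<in> K" "y \<in> K" for x y
    using assms(3)[OF that(1) scaleC[OF that(2), of "-1"]] by (simp add: scaleC_minus_one)
  have uniq: "f x = y" if "y \<in> K" "\<And>k. k \<in> K \<Longrightarrow> cinner (x - y) k = 0" for x y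
  proof -
    have "cinner (f x - y) k = 0" if "k \<in> K" for k
      using f[of k x] \<open>k \<in> K\<close> that(1) \<open>\<And>k. k \<in> K \<Longrightarrow> cinner (x - y) k = 0\<close>[of k]
      by (simp add: cinner_diff_left)
    then have "cinner (f x - y) (f x - y) = 0" using diffK[OF fK that(1)] by blast
    then show ?thesis by (simp add: cinner_self)
  qed
  have add: "f (x + y) = f x + f y" for x y
  proof (rule uniq)
    show "cinner (x + y - (f x + f y)) k = 0" if "k \<in> K" for k
      using f[OF that, of x] f[OF that, of y] by (simp add: cinner_diff_left cinner_add_left)
  qed (simp add: assms(3) fK)
  have sc: "f (c *\<^sub>C x) = c *\<^sub>C f x" for c x
  proof (rule uniq)
    show "cinner (c *\<^sub>C x - c *\<^sub>C f x) k = 0" if "k \<in> K" for k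
      using f[OF that, of x] by (simp add: cinner_scaleC_left flip: scaleC_diff_right)
  qed (simp add: scaleC fK)
  have "norm (f x) \<le> norm x * 1" for x
  proof -
    have "(norm x)\<^sup>2 = (norm (x - f x))\<^sup>2 + (norm (f x))\<^sup>2"
      using norm_add_square[of "x - f x" "f x"] f[OF fK, of x x] by simp
    then show ?thesis by (simp add: power2_le_imp_le)
  qed
  then have lin: "bounded_linear f"
    by (intro bounded_linear_intro[OF add, where K = 1]) (auto simp: scaleR_eq_scaleC sc)
  have ff: "f x = x \<longleftrightarrow> x \<in> K" for x using uniq[of x x] fK[of x] by auto
  have "cinner (f x) y = cinner x (f y)" for x y
    using f[OF fK, of x y] f[OF fK, of y x] cinner_zero_commute[of "y - f y" "f x"]
    by (simp add: cinner_diff_left cinner_diff_right)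
  then have "projection (Blinfun f)"
    by (simp add: projection_iff bounded_ops_def bounded_linear_Blinfun_apply[OF lin] sc ff fK)
  then show ?thesis using ff by (auto simp: bounded_linear_Blinfun_apply[OF lin])
qed

section \<open>Orthogonal sums and choices of signs\<close>

lemma norm_sum_orthogonal:
  fixes v :: "'i \<Rightarrow> 'a::complex_inner"
  assumes "finite I" "\<And>i j. i \<in> I \<Longrightarrow> j \<in> I \<Longrightarrow> i \<noteq> j \<Longrightarrow> cinner (v i) (v j) = 0"
  shows "(norm (\<Sum>i\<in>I. v i))\<^sup>2 = (\<Sum>i\<in>I. (norm (v i))\<^sup>2)"
  using assms
proof (induction I)
  case (insert a I)
  have "cinner (v a) (\<Sum>i\<in>J. v i) = 0" if "finite J" "J \<subseteq> I" for J
    using that insert.prems insert.hyps(2)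
    by (induction J) (auto simp: cinner_add_right)
  then show ?case using insert by (simp add: norm_add_square)
qed simp

text \<open>Signs are chosen one vector at a time: by the parallelogram law, one of
  \<open>w + u a\<close> and \<open>w - u a\<close> has squared norm at least the sum of both
  squared norms. \<open>T\<close> collects the indices with sign plus.\<close>

lemma exists_signs:
  fixes u :: "'i \<Rightarrow> 'a::complex_inner"
  assumes "finite I"
  shows "\<exists>T\<subseteq>I. (\<Sum>i\<in>I. (norm (u i))\<^sup>2) \<le> (norm ((\<Sum>i\<in>T. u i) - (\<Sum>i\<in>I - T. u i)))\<^sup>2"
  using assms
proof (induction I)
  case (insert a I)
  then obtain T where T: "T \<subseteq> I" and le: "(\<Sum>i\<in>I. (norm (u i))\<^sup>2) \<le> (norm ((\<Sum>i\<in>T. u i) - (\<Sum>i\<in>I - T. u i)))\<^sup>2"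
    by blast
  define w where "w = (\<Sum>i\<in>T. u i) - (\<Sum>i\<in>I - T. u i)"
  have fin: "finite T" "finite (I - T)" "a \<notin> T" using insert T finite_subset by auto
  have S: "(\<Sum>i\<in>insert a I. (norm (u i))\<^sup>2) \<le> (norm w)\<^sup>2 + (norm (u a))\<^sup>2"
    using insert le by (simp add: w_def)
  consider "(norm w)\<^sup>2 + (norm (u a))\<^sup>2 \<le> (norm (w + u a))\<^sup>2" | "(norm w)\<^sup>2 + (norm (u a))\<^sup>2 \<le> (norm (w - u a))\<^sup>2"
    using parallelogram[of w "u a"] by linarith
  then show ?case
  proof cases
    case 1
    have "(\<Sum>i\<in>insert a T. u i) - (\<Sum>i\<in>insert a I - insert a T. u i) = w + u a"
      using fin insert.hyps by (simp add: w_def)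
    then show ?thesis using 1 S T by (intro exI[of _ "insert a T"]) auto
  next
    case 2
    have "insert a I - T = insert a (I - T)" using fin by auto
    then have "(\<Sum>i\<in>T. u i) - (\<Sum>i\<in>insert a I - T. u i) = w - u a"
      using fin insert.hyps by (simp add: w_def)
    then show ?thesis using 2 S T by (intro exI[of _ T]) auto
  qed
qed simp

section \<open>Projections in abelian von Neumann algebras\<close>

text \<open>A closed subspace invariant under the commutant is the range of a projection of the algebra,
  by the double commutant property; this provides all suprema and infima of projections.\<close>

lemma commutant_cadjoint:
  assumes "\<forall>a\<in>D. cadjoint a \<in> D" "D \<subseteq> bounded_ops" "T \<in> commutant D"
  shows "cadjoint T \<in> commutant D"
proof -
  have T: "T \<in> bounded_ops" and comm: "\<And>a x. a \<in> D \<Longrightarrow> T (a x) = a (T x)"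
    using assms(3) by (auto simp: commutant_def blinfun_apply_inject[symmetric] fun_eq_iff)
  have "cadjoint T (a y) = a (cadjoint T y)" if a: "a \<in> D" for a y
  proof (rule cinner_eqI)
    fix x
    have ab: "a \<in> bounded_ops" "cadjoint a \<in> D" "cadjoint a \<in> bounded_ops" using a assms(1,2) by auto
    have adj: "cinner x (a y) = cinner (cadjoint a x) y" for x y
      by (metis cadjoint(2)[OF ab(1)] cinner_commute)
    show "cinner x (cadjoint T (a y)) = cinner x (a (cadjoint T y))"
      using comm[OF ab(2)] by (simp add: cadjoint(2)[OF T, symmetric] adj)
  qed
  then show ?thesis
    using cadjoint(1)[OF T] by (auto simp: commutant_def intro!: blinfun_eqI)
qed

lemma von_neumann_algebra_kernel_projection:
  assumes D: "von_neumann_algebra D" and S: "S \<subseteq> D"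
  shows "\<exists>e\<in>D. projection e \<and> (\<forall>x. e x = x \<longleftrightarrow> (\<forall>a\<in>S. a x = 0))"
proof -
  have Db: "D \<subseteq> bounded_ops" and Dadj: "\<forall>a\<in>D. cadjoint a \<in> D" and DD: "commutant (commutant D) = D"
    using D by (auto simp: von_neumann_algebra_def)
  define K where "K = {x. \<forall>a\<in>S. a x = 0}"
  have "K = (\<Inter>a\<in>S. {x. blinfun_apply a x = 0})" by (auto simp: K_def)
  also have "closed \<dots>"
    by (intro closed_INT ballI closed_Collect_eq continuous_intros)
  finally have "closed K" .
  moreover have "c *\<^sub>C x \<in> K" if "x \<in> K" for c x
    using that S Db by (auto simp: K_def bounded_ops_def subset_iff)
  ultimately obtain p where p: "projection p" and pK: "\<And>x. p x = x \<longleftrightarrow> x \<in> K"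
    using projection_exists[of K] by (auto simp: K_def blinfun.bilinear_simps)
  have pp: "p (p x) = p x" and padj: "cinner (p x) y = cinner x (p y)" for x y
    using p by (auto simp: projection_iff)
  \<comment> \<open>Since \<open>T\<close> commutes with \<open>S\<close>, it preserves the common
    kernel \<open>K\<close>, which is the range of \<open>p\<close>.\<close>
  have inv: "p (T (p x)) = T (p x)" if "T \<in> commutant D" for T x
  proof -
    have "p x \<in> K" using pK pp by metis
    moreover have comm: "T (a y) = a (T y)" if "a \<in> S" for a y
      using \<open>T \<in> commutant D\<close> that S
      by (auto simp: commutant_def blinfun_apply_inject[symmetric] fun_eq_iff)
    ultimately have "T (p x) \<in> K" by (simp add: K_def flip: comm)
    then show ?thesis using pK by blast
  qed
  have "p o\<^sub>L T = T o\<^sub>L p" if T: "T \<in> commutant D" for T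
  proof -
    have Tb: "T \<in> bounded_ops" using T by (simp add: commutant_def)
    have "p (T y) = T (p y)" for y
    proof -
      \<comment> \<open>The adjoint of \<open>T\<close> also lies in the commutant and preserves
        \<open>K\<close>, so \<open>T\<close> preserves the orthogonal complement of
        \<open>K\<close>.\<close>
      have "p (T y) = p (T (p y))"
      proof (rule cinner_eqI)
        fix x
        have Tc: "cadjoint T \<in> commutant D" by (rule commutant_cadjoint[OF Dadj Db T])
        have adj: "cinner x (T y) = cinner (cadjoint T x) y" for x y
          by (metis cadjoint(2)[OF Tb] cinner_commute)
        show "cinner x (p (T y)) = cinner x (p (T (p y)))"
          by (simp add: padj[symmetric] adj inv[OF Tc])
      qed
      then show ?thesis using inv[OF T] by simp
    qed
    then show ?thesis by (auto intro: blinfun_eqI)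
  qed
  then have "p \<in> commutant (commutant D)" using p by (simp add: commutant_def projection_iff)
  then have "p \<in> D" using DD by simp
  then show ?thesis using p pK by (auto simp: K_def)
qed


section \<open>The projections of an abelian von Neumann algebra\<close>

locale abelian_von_neumann_algebra =
  fixes D :: "('h::chilbert_space \<Rightarrow>\<^sub>L 'h) set"
  assumes vn: "von_neumann_algebra D" and abelian: "abelian D"
begin

definition projections :: "('h \<Rightarrow>\<^sub>L 'h) set" where
  "projections = {p \<in> D. projection p}"

lemma diff_closed: "a \<in> D \<Longrightarrow> b \<in> D \<Longrightarrow> a - b \<in> D"
  using von_neumann_algebra_unital_subalgebra(2)[OF vn, of a "- b"]
    von_neumann_algebra_unital_subalgebra(4)[OF vn, of b "-1"]
  by (simp add: scaleC_minus_one)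

lemma zero_in_projections: "0 \<in> projections"
  using diff_closed[OF von_neumann_algebra_unital_subalgebra(1,1)[OF vn]]
  by (simp add: projections_def)

lemma id_in_projections: "id_blinfun \<in> projections"
  using von_neumann_algebra_unital_subalgebra(1)[OF vn] by (simp add: projections_def)

lemma projections_commute: "p \<in> projections \<Longrightarrow> q \<in> projections \<Longrightarrow> p (q x) = q (p x)"
  using abelian unfolding abelian_def projections_def
  by (metis (no_types, lifting) blinfun_apply_blinfun_compose mem_Collect_eq)

lemma projections_idem: "p \<in> projections \<Longrightarrow> p (p x) = p x"
  by (simp add: projections_def projection_iff)

lemma projections_compl: "p \<in> projections \<Longrightarrow> id_blinfun - p \<in> projections"
  using diff_closed von_neumann_algebra_unital_subalgebra(1)[OF vn]
  by (simp add: projections_def projection_compl)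

lemma projections_compose: "p \<in> projections \<Longrightarrow> q \<in> projections \<Longrightarrow> p o\<^sub>L q \<in> projections"
  using abelian von_neumann_algebra_unital_subalgebra(3)[OF vn]
  by (simp add: projections_def abelian_def projection_compose)

lemma projections_compose_commute: "p \<in> projections \<Longrightarrow> q \<in> projections \<Longrightarrow> p o\<^sub>L q = q o\<^sub>L p"
  using abelian by (simp add: projections_def abelian_def)

lemma projections_add: "p \<in> projections \<Longrightarrow> q \<in> projections \<Longrightarrow> p o\<^sub>L q = 0 \<Longrightarrow> p + q \<in> projections"
  using von_neumann_algebra_unital_subalgebra(2)[OF vn] by (simp add: projections_def projection_add)

lemma projections_diff:
  assumes "p \<in> projections" "q \<in> projections" "p o\<^sub>L q = p"
  shows "q - p \<in> projections"
proof -
  have "p (q x) = p x" for x using assms(3) by (metis blinfun_apply_blinfun_compose)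
  then have "q - p = q o\<^sub>L (id_blinfun - p)"
    using projections_commute[OF assms(1,2)]
    by (auto intro!: blinfun_eqI simp: blinfun.bilinear_simps)
  then show ?thesis using projections_compose[OF assms(2) projections_compl[OF assms(1)]] by simp
qed

lemma sum_projections:
  assumes "finite I" "\<And>i. i \<in> I \<Longrightarrow> p i \<in> projections"
    and "\<And>i j. i \<in> I \<Longrightarrow> j \<in> I \<Longrightarrow> i \<noteq> j \<Longrightarrow> p i o\<^sub>L p j = 0"
  shows "(\<Sum>i\<in>I. p i) \<in> projections"
  using assms
proof (induction I)
  case (insert a I)
  have "p a (p i x) = 0" if "i \<in> I" for i x
    using insert.prems(2)[of a i] insert.hyps that
    by (metis blinfun_apply_blinfun_compose insertCI zero_blinfun.rep_eq)
  then have "p a o\<^sub>L (\<Sum>i\<in>I. p i) = 0"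
    by (auto intro!: blinfun_eqI simp: blinfun.sum_left blinfun.sum_right)
  then show ?case using insert by (simp add: projections_add)
qed (simp add: zero_in_projections)

text \<open>Infima come from taking complements as \<open>S\<close>; differences of projections as
  \<open>S\<close> give the largest projection on whose range they agree.\<close>

lemma kernel_projection:
  assumes "S \<subseteq> D"
  obtains e where "e \<in> projections" "\<And>x. e x = x \<longleftrightarrow> (\<forall>a\<in>S. a x = 0)"
  using von_neumann_algebra_kernel_projection[OF vn assms] by (auto simp: projections_def)

text \<open>\<open>a\<close> is the complement of the supremum of the differences
  \<open>q n - p n\<close>. It fixes the range of every \<open>p n\<close>, because there all these
  differences vanish by orthogonality.\<close>

lemma orthogonal_sup:
  assumes q: "\<And>n::nat. q n \<in> projections" and orth: "\<And>m n. m \<noteq> n \<Longrightarrow> q m o\<^sub>L q n = 0"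
    and p: "\<And>n. p n \<in> projections" and le: "\<And>n. p n o\<^sub>L q n = p n"
  shows "\<exists>a\<in>projections. \<forall>n. a o\<^sub>L q n = p n"
proof -
  have pq: "p n (q n x) = p n x" for n x using le by (metis blinfun_apply_blinfun_compose)
  have qp: "q n (p n x) = p n x" for n x using pq projections_commute[OF p q] by simp
  have qq: "q m (q n x) = 0" if "m \<noteq> n" for m n x
    using orth[OF that] by (metis blinfun_apply_blinfun_compose zero_blinfun.rep_eq)
  have "range (\<lambda>n. q n - p n) \<subseteq> D" using q p diff_closed by (auto simp: projections_def)
  then obtain a where a: "a \<in> projections" and ax: "\<And>x. a x = x \<longleftrightarrow> (\<forall>n. q n x - p n x = 0)"
    by (rule kernel_projection) (auto simp: blinfun.diff_left)
  have "q m (p n x) = p m (p n x)" for m n x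
  proof (cases "m = n")
    case False
    have "q m (p n x) = q m (q n (p n x))" by (simp add: qp)
    also have "\<dots> = 0" using qq False by blast
    finally have 0: "q m (p n x) = 0" .
    then have "p m (p n x) = 0" using pq by (metis blinfun.zero_right)
    with 0 show ?thesis by simp
  qed (simp add: qp projections_idem[OF p])
  then have apn: "a (p n x) = p n x" for n x by (simp add: ax)
  have "a (q n x) = p n x" for n x
  proof -
    \<comment> \<open>On the range of \<open>a\<close> the projections \<open>q n\<close> and
      \<open>p n\<close> agree; commuting \<open>a\<close> to the left then gives the claim.\<close>
    have "q n (a x) = p n (a x)" using ax[of "a x"] projections_idem[OF a] by simp
    then show ?thesis using projections_commute[OF a q] projections_commute[OF a p] apn by metis
  qed
  then have "a o\<^sub>L q n = p n" for n by (auto intro!: blinfun_eqI)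
  then show ?thesis using a by blast
qed

text \<open>A chain of projections converges strongly to its infimum. A sequence minimizing the norm
  at \<open>\<zeta>\<close> is Cauchy, and its limit is fixed by the whole chain, hence equals
  \<open>e \<zeta>\<close>.\<close>

lemma chain_inf_approx:
  assumes E: "E \<subseteq> projections" "E \<noteq> {}" and chain: "\<And>c d. c \<in> E \<Longrightarrow> d \<in> E \<Longrightarrow> c o\<^sub>L d = c \<or> c o\<^sub>L d = d"
    and e: "e \<in> projections" "\<And>x. e x = x \<longleftrightarrow> (\<forall>c\<in>E. c x = x)" and "\<eta> > 0"
  shows "\<exists>c\<in>E. norm (c \<zeta> - e \<zeta>) < \<eta>"
proof -
  define m where "m = (INF c\<in>E. (norm (blinfun_apply c \<zeta>))\<^sup>2)"
  have bdd: "bdd_below ((\<lambda>c. (norm (blinfun_apply c \<zeta>))\<^sup>2) ` E)" by (rule bdd_belowI2[of _ 0]) simp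
  have m_le: "m \<le> (norm (c \<zeta>))\<^sup>2" if "c \<in> E" for c unfolding m_def by (rule cINF_lower[OF bdd that])
  have "\<exists>c\<in>E. (norm (c \<zeta>))\<^sup>2 < m + inverse (real (Suc n))" for n
  proof -
    have "(INF c\<in>E. (norm (blinfun_apply c \<zeta>))\<^sup>2) < m + inverse (real (Suc n))" unfolding m_def by simp
    then show ?thesis using E(2) by (subst (asm) cINF_less_iff[OF _ bdd]) auto
  qed
  then obtain X where XE: "\<And>n. X n \<in> E" and X: "\<And>n. (norm (X n \<zeta>))\<^sup>2 < m + inverse (real (Suc n))"
    by metis
  \<comment> \<open>If \<open>c\<close> lies below \<open>X n\<close>, Pythagoras and the minimality
    of \<open>m\<close> bound the difference; if \<open>c\<close> lies above, the difference is
    zero.\<close>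
  have near: "(norm (X n \<zeta> - c (X n \<zeta>)))\<^sup>2 \<le> inverse (real (Suc n))" if "c \<in> E" for c n
    using chain[OF that XE[of n]]
  proof
    assume "c o\<^sub>L X n = c"
    then have "c (X n \<zeta>) = c \<zeta>" by (metis blinfun_apply_blinfun_compose)
    moreover have "projection c" using that E(1) by (auto simp: projections_def)
    ultimately show ?thesis
      using projection_pythagoras[of c "X n \<zeta>"] m_le[OF that] X[of n] by simp
  next
    assume "c o\<^sub>L X n = X n"
    then show ?thesis by (metis blinfun_apply_blinfun_compose diff_self norm_zero power_zero_numeral
          inverse_nonnegative_iff_nonnegative of_nat_0_le_iff)
  qed
  have near': "(norm (X a \<zeta> - X b \<zeta>))\<^sup>2 \<le> max (inverse (real (Suc a))) (inverse (real (Suc b)))" for a b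
  proof -
    have "X a (X b \<zeta>) = X b (X a \<zeta>)" using projections_commute XE E(1) by blast
    moreover have "X a (X b \<zeta>) = X a \<zeta> \<or> X a (X b \<zeta>) = X b \<zeta>"
      using chain[OF XE[of a] XE[of b]] by (metis blinfun_apply_blinfun_compose)
    ultimately show ?thesis
      using near[OF XE[of a], of b] near[OF XE[of b], of a] by (auto simp: norm_minus_commute)
  qed
  have "Cauchy (\<lambda>n. X n \<zeta>)"
  proof (rule metric_CauchyI)
    fix r :: real assume "r > 0"
    then obtain N where N: "inverse (real (Suc N)) < r\<^sup>2" using reals_Archimedean[of "r\<^sup>2"] by auto
    have "dist (X a \<zeta>) (X b \<zeta>) < r" if "a \<ge> N" "b \<ge> N" for a b
    proof -
      have "inverse (real (Suc a)) \<le> inverse (real (Suc N))" "inverse (real (Suc b)) \<le> inverse (real (Suc N))"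
        using that by (auto intro!: le_imp_inverse_le)
      then have "(norm (X a \<zeta> - X b \<zeta>))\<^sup>2 < r\<^sup>2" using near'[of a b] N by linarith
      then show ?thesis using \<open>r > 0\<close> by (simp add: dist_norm power_less_imp_less_base)
    qed
    then show "\<exists>M. \<forall>a\<ge>M. \<forall>b\<ge>M. dist (X a \<zeta>) (X b \<zeta>) < r" by blast
  qed
  then obtain v where v: "(\<lambda>n. X n \<zeta>) \<longlonglongrightarrow> v" using Cauchy_convergent convergent_def by blast
  have "c v = v" if c: "c \<in> E" for c
  proof -
    have "(\<lambda>n. (norm (X n \<zeta> - c (X n \<zeta>)))\<^sup>2) \<longlonglongrightarrow> 0"
      by (rule tendsto_sandwich[OF _ _ tendsto_const LIMSEQ_inverse_real_of_nat])
        (simp, intro always_eventually allI near[OF c])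
    moreover have "(\<lambda>n. (norm (X n \<zeta> - c (X n \<zeta>)))\<^sup>2) \<longlonglongrightarrow> (norm (v - c v))\<^sup>2"
      by (intro tendsto_intros v)
    ultimately have "(norm (v - c v))\<^sup>2 = 0" using LIMSEQ_unique by blast
    then show ?thesis by simp
  qed
  then have ev: "e v = v" using e(2) by blast
  have "e (X n \<zeta>) = e \<zeta>" for n
  proof -
    have "X n (e \<zeta>) = e \<zeta>" using e(2)[of "e \<zeta>"] projections_idem[OF e(1)] XE by blast
    then show ?thesis using projections_commute[OF e(1)] XE E(1) by (metis subsetD)
  qed
  moreover have "(\<lambda>n. e (X n \<zeta>)) \<longlonglongrightarrow> e v" by (intro tendsto_intros v)
  ultimately have "e \<zeta> = v" using ev by (simp add: LIMSEQ_const_iff)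
  then obtain n where "dist (X n \<zeta>) (e \<zeta>) < \<eta>" using v \<open>\<eta> > 0\<close> by (meson LIMSEQ_iff_nz le_refl lim_sequentially)
  then show ?thesis using XE by (auto simp: dist_norm)
qed

section \<open>Finite partitions into pieces that are small at a vector\<close>

definition small_partition :: "'h \<Rightarrow> real \<Rightarrow> ('h \<Rightarrow>\<^sub>L 'h) \<Rightarrow> ('h \<Rightarrow>\<^sub>L 'h) set \<Rightarrow> bool" where
  "small_partition \<zeta> \<eta> e A \<longleftrightarrow> finite A \<and> A \<subseteq> projections - {0} \<and>
     (\<forall>a\<in>A. \<forall>b\<in>A. a \<noteq> b \<longrightarrow> a o\<^sub>L b = 0) \<and> \<Sum>A = e \<and> (\<forall>a\<in>A. norm (a \<zeta>) \<le> \<eta>)"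

lemma small_partition_single:
  "p \<in> projections \<Longrightarrow> norm (p \<zeta>) \<le> \<eta> \<Longrightarrow> \<exists>A. small_partition \<zeta> \<eta> p A"
  by (rule exI[of _ "if p = 0 then {} else {p}"]) (auto simp: small_partition_def)

lemma partition_below:
  assumes "small_partition \<zeta> \<eta> e A" "a \<in> A"
  shows "a (e x) = a x"
proof -
  have fin: "finite A" and orth: "\<And>b. b \<in> A \<Longrightarrow> a \<noteq> b \<Longrightarrow> a o\<^sub>L b = 0" and e: "e = \<Sum>A"
    using assms by (auto simp: small_partition_def)
  have "a (b x) = 0" if "b \<in> A - {a}" for b
    using orth[of b] that by (metis DiffD1 DiffD2 blinfun_apply_blinfun_compose singletonI zero_blinfun.rep_eq)
  then have "a (e x) = a (a x)"
    by (simp add: e sum.remove[OF fin assms(2)] blinfun.add_left blinfun.add_right blinfun.sum_left blinfun.sum_right)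
  then show ?thesis using assms projections_idem by (auto simp: small_partition_def)
qed

lemma small_partition_add:
  assumes A: "small_partition \<zeta> \<eta> e A" and B: "small_partition \<zeta> \<eta> f B"
    and e: "e \<in> projections" and f: "f \<in> projections" and ef: "e o\<^sub>L f = 0"
  shows "small_partition \<zeta> \<eta> (e + f) (A \<union> B)"
proof -
  have ap: "a \<in> projections" "a \<noteq> 0" if "a \<in> A \<union> B" for a using that A B by (auto simp: small_partition_def)
  have "a (b x) = 0" if ab: "a \<in> A" "b \<in> B" for a b x
  proof -
    have "a (b x) = b (a (e x))"
      using partition_below[OF A ab(1)] projections_commute ap ab by (metis UnCI)
    also have "\<dots> = b (f (e (a x)))"
      using partition_below[OF B ab(2)] projections_commute[OF _ e] ap ab by (metis UnCI)
    also have "f (e (a x)) = 0"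
      using ef projections_commute[OF f e] by (metis blinfun_apply_blinfun_compose zero_blinfun.rep_eq)
    finally show ?thesis by (simp add: blinfun.zero_right)
  qed
  then have AB: "a o\<^sub>L b = 0" if "a \<in> A" "b \<in> B" for a b using that by (auto intro!: blinfun_eqI)
  \<comment> \<open>A common piece would be orthogonal to itself, hence zero, which partitions
    exclude. Thus the sum over the union has no lost multiplicities.\<close>
  have "A \<inter> B = {}"
  proof (rule ccontr)
    assume "A \<inter> B \<noteq> {}"
    then obtain a where "a \<in> A" "a \<in> B" by blast
    then have "a = 0" using AB[of a a] projections_idem ap
      by (metis UnCI blinfun_apply_blinfun_compose blinfun_eqI)
    then show False using ap \<open>a \<in> A\<close> by blast
  qed
  moreover have "b o\<^sub>L a = 0" if "a \<in> A" "b \<in> B" for a b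
    using AB[OF that] projections_compose_commute ap that by (metis UnCI)
  ultimately show ?thesis
    using A B AB unfolding small_partition_def by (auto simp: sum.union_disjoint)
qed

end

section \<open>Splitting projections in the diffuse case\<close>

locale diffuse_abelian_von_neumann_algebra = abelian_von_neumann_algebra +
  assumes diffuse: "diffuse D"
begin

lemma split_projection:
  assumes "q \<in> projections" "q \<noteq> 0"
  obtains e f where "e \<in> projections" "f \<in> projections" "e \<noteq> 0" "f \<noteq> 0" "e o\<^sub>L f = 0" "q = e + f"
proof -
  obtain e where e: "e \<in> projections" "e \<noteq> 0" "e \<noteq> q" "q o\<^sub>L e = e"
    using diffuse assms unfolding diffuse_def minimal_projection_def projections_def by blast
  have eq: "e o\<^sub>L q = e" using e projections_compose_commute assms by metis
  have "e (q x - e x) = 0" for x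
    using eq projections_idem[OF e(1)] by (metis blinfun.diff_right blinfun_apply_blinfun_compose diff_self)
  then have "e o\<^sub>L (q - e) = 0" by (auto intro!: blinfun_eqI simp: blinfun.diff_left)
  then show ?thesis using that[of e "q - e"] e projections_diff[OF e(1) assms(1) eq] by auto
qed

text \<open>Starting from the identity, each remainder \<open>e n\<close> is split in two:
  \<open>s (e n)\<close> joins the sequence and \<open>t (e n)\<close> is split further. Later terms
  lie below \<open>e (Suc m)\<close>, which is orthogonal to \<open>s (e m)\<close>.\<close>

lemma orthogonal_sequence:
  assumes "D \<noteq> {0}"
  obtains q where "\<And>n::nat. q n \<in> projections" "\<And>n. q n \<noteq> 0" "\<And>m n. m \<noteq> n \<Longrightarrow> q m o\<^sub>L q n = 0"
proof -
  have nz: "id_blinfun \<noteq> (0 :: 'a \<Rightarrow>\<^sub>L 'a)"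
  proof
    assume "id_blinfun = (0 :: 'a \<Rightarrow>\<^sub>L 'a)"
    then have zero: "x = 0" for x :: 'a by (metis blinfun_apply_id_blinfun id_apply zero_blinfun.rep_eq)
    then have "a = 0" for a :: "'a \<Rightarrow>\<^sub>L 'a" by (intro blinfun_eqI) (metis zero)
    moreover have "0 \<in> D" using zero_in_projections by (simp add: projections_def)
    ultimately show False using assms by blast
  qed
  have "\<exists>e f. q \<in> projections - {0} \<longrightarrow> e \<in> projections - {0} \<and> f \<in> projections - {0} \<and> e o\<^sub>L f = 0 \<and> q = e + f" for q
    by (metis DiffE DiffI singletonD singletonI split_projection)
  then obtain s t where st: "\<And>q. q \<in> projections - {0} \<Longrightarrow>
      s q \<in> projections - {0} \<and> t q \<in> projections - {0} \<and> s q o\<^sub>L t q = 0 \<and> q = s q + t q"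
    by metis
  define e where "e n = (t ^^ n) id_blinfun" for n
  have e: "e n \<in> projections - {0}" for n
    by (induction n) (use st id_in_projections nz in \<open>auto simp: e_def\<close>)
  have es: "e (Suc n) = t (e n)" for n by (simp add: e_def)
  have ss: "s (e n) \<in> projections" "s (e n) \<noteq> 0" "s (e n) (e (Suc n) x) = 0"
      "e n x = s (e n) x + e (Suc n) x" for n x
    using st[OF e[of n]] es[of n]
    by (auto simp: blinfun.add_left[symmetric]) (metis blinfun_apply_blinfun_compose zero_blinfun.rep_eq)
  have pe: "e n \<in> projections" for n using e by blast
  have se: "s (e n) x = e n (s (e n) x)" for n x
    using ss(3)[of n] projections_commute[OF ss(1) pe] projections_idem[OF ss(1)]
    by (simp add: ss(4)[of n "s (e n) x"])
  have dec: "e (m + k) x = e m (e (m + k) x)" for m k x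
  proof (induction k arbitrary: x)
    case (Suc k)
    have "e (m + Suc k) x = e (m + k) (e (m + Suc k) x)"
      using ss(3)[of "m + k"] projections_idem[OF pe] by (simp add: ss(4)[of "m + k" "e (Suc (m + k)) x"])
    then show ?case using Suc by metis
  qed (simp add: projections_idem[OF pe])
  have lt: "s (e m) (s (e n) x) = 0" if "m < n" for m n x
  proof -
    obtain k where n: "n = Suc m + k" using less_imp_Suc_add[OF \<open>m < n\<close>] by auto
    have "s (e n) x = e (Suc m) (e n (s (e n) x))" using se dec[of "Suc m" k] n by metis
    then show ?thesis using ss(3) by metis
  qed
  have "s (e m) (s (e n) x) = 0" if "m \<noteq> n" for m n x
    using lt[of m n] lt[of n m] that projections_commute[OF ss(1) ss(1)] by (metis linorder_neqE_nat)
  then have "s (e m) o\<^sub>L s (e n) = 0" if "m \<noteq> n" for m n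
    using that by (auto intro!: blinfun_eqI)
  then show ?thesis using that[of "\<lambda>n. s (e n)"] ss by blast
qed

text \<open>By Zorn's lemma, a projection without a small partition dominates a minimal such projection,
  which could then not be split.\<close>

lemma small_partition_exists:
  assumes "\<eta> > 0"
  shows "\<exists>A. small_partition \<zeta> \<eta> id_blinfun A"
proof (rule ccontr)
  define bad where "bad = {p \<in> projections. \<nexists>A. small_partition \<zeta> \<eta> p A}"
  \<comment> \<open>Encodes the order of projections by inclusion, as Zorn's lemma for sets
    requires: larger kernels belong to smaller projections, so a maximal kernel gives a minimal bad
    projection.\<close>
  define ker :: "('a \<Rightarrow>\<^sub>L 'a) \<Rightarrow> 'a set" where "ker p = {x. p x = 0}" for p
  assume "\<nexists>A. small_partition \<zeta> \<eta> id_blinfun A"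
  then have id: "id_blinfun \<in> bad" using id_in_projections by (simp add: bad_def)
  have badp: "c \<in> projections" if "c \<in> bad" for c using that by (simp add: bad_def)
  have ker_le: "d (c x) = d x" if "ker c \<subseteq> ker d" "c \<in> projections" for c d x
  proof -
    have "x - c x \<in> ker c" using projections_idem[OF that(2)] by (simp add: ker_def blinfun.diff_right)
    then have "d (x - c x) = 0" using that(1) by (auto simp: ker_def)
    then show ?thesis by (simp add: blinfun.diff_right)
  qed
  have "\<exists>M\<in>ker ` bad. \<forall>X\<in>ker ` bad. M \<subseteq> X \<longrightarrow> X = M"
  proof (rule subset_Zorn)
    fix C assume C: "subset.chain (ker ` bad) C"
    show "\<exists>U\<in>ker ` bad. \<forall>X\<in>C. X \<subseteq> U"
    proof (cases "C = {}")
      case False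
      define E where "E = {c \<in> bad. ker c \<in> C}"
      have CE: "X \<in> C \<Longrightarrow> \<exists>c\<in>E. X = ker c" for X
        using C by (auto simp: E_def subset.chain_def)
      have E: "E \<subseteq> projections" "E \<noteq> {}" using False CE by (auto simp: E_def bad_def)
      have "(\<lambda>c. id_blinfun - c) ` E \<subseteq> D"
        using E(1) projections_compl by (auto simp: projections_def)
      then obtain e where e: "e \<in> projections" and "\<And>x. e x = x \<longleftrightarrow> (\<forall>c\<in>E. x - c x = 0)"
        by (rule kernel_projection) (auto simp: blinfun.diff_left)
      then have ex: "e x = x \<longleftrightarrow> (\<forall>c\<in>E. c x = x)" for x by (metis eq_iff_diff_eq_0)
      have chain: "c o\<^sub>L d = c \<or> c o\<^sub>L d = d" if "c \<in> E" "d \<in> E" for c d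
      proof -
        have "ker c \<subseteq> ker d \<or> ker d \<subseteq> ker c"
          using C that unfolding E_def subset.chain_def by blast
        then have "d o\<^sub>L c = d \<or> c o\<^sub>L d = c"
          using ker_le[of c d] ker_le[of d c] that E(1) by (auto intro!: blinfun_eqI)
        moreover have "c o\<^sub>L d = d o\<^sub>L c"
          using projections_compose_commute that E(1) by blast
        ultimately show ?thesis by metis
      qed
      have ec: "e (c x) = e x" if "c \<in> E" for c x
        using ex[of "e x"] projections_idem[OF e] that projections_commute[OF e] E(1) by (metis subsetD)
      \<comment> \<open>If the infimum \<open>e\<close> had a small partition, some \<open>c\<close>
        of the chain would be so close to \<open>e\<close> at \<open>\<zeta>\<close> that
        \<open>c - e\<close> could serve as one further piece, and \<open>c\<close> would not be
        bad.\<close>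
      have "e \<in> bad"
      proof (rule ccontr)
        assume "e \<notin> bad"
        then obtain A where A: "small_partition \<zeta> \<eta> e A" using e by (auto simp: bad_def)
        obtain c where c: "c \<in> E" "norm (c \<zeta> - e \<zeta>) < \<eta>"
          using chain_inf_approx[OF E chain e ex assms] by blast
        have "c \<in> projections" "e o\<^sub>L c = e" using ec[OF c(1)] c(1) E(1) by (auto intro!: blinfun_eqI)
        then have ce: "c - e \<in> projections" using projections_diff e by blast
        then obtain B where B: "small_partition \<zeta> \<eta> (c - e) B"
          using small_partition_single[of "c - e" \<zeta> \<eta>] c(2) by (auto simp: blinfun.diff_left)
        have "e o\<^sub>L (c - e) = 0"
          using ec[OF c(1)] projections_idem[OF e] by (auto intro!: blinfun_eqI simp: blinfun.bilinear_simps)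
        then have "small_partition \<zeta> \<eta> c (A \<union> B)"
          using small_partition_add[OF A B e ce] by simp
        then show False using c(1) by (auto simp: E_def bad_def)
      qed
      moreover have "X \<subseteq> ker e" if "X \<in> C" for X
        using CE[OF that] ec by (metis (mono_tags, lifting) blinfun.zero_right ker_def mem_Collect_eq subsetI)
      ultimately show ?thesis by blast
    qed (use id in blast)
  qed
  then obtain e where e: "e \<in> bad" and max: "\<And>f. f \<in> bad \<Longrightarrow> ker e \<subseteq> ker f \<Longrightarrow> ker f = ker e"
    by blast
  have "e \<noteq> 0" using e small_partition_single[OF zero_in_projections, of \<zeta> \<eta>] assms by (auto simp: bad_def)
  then obtain f g where fg: "f \<in> projections" "g \<in> projections" "f \<noteq> 0" "g \<noteq> 0" "f o\<^sub>L g = 0" "e = f + g"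
    using split_projection[OF badp[OF e]] by blast
  \<comment> \<open>For bad \<open>f\<close>, maximality gives \<open>ker f = ker e\<close>. As
    \<open>f\<close> kills the range of \<open>g\<close>, so does \<open>e\<close>, which forces
    \<open>g = 0\<close>.\<close>
  have *: "f \<notin> bad" if "f \<in> projections" "g \<in> projections" "g \<noteq> 0" "f o\<^sub>L g = 0" "e = f + g" for f g
  proof
    assume f: "f \<in> bad"
    have fgx: "f (g x) = 0" "g (f x) = 0" for x
      using that projections_commute by (metis blinfun_apply_blinfun_compose zero_blinfun.rep_eq)+
    have "ker e \<subseteq> ker f"
    proof
      fix x assume "x \<in> ker e"
      then have "f (f x + g x) = 0" by (simp add: ker_def that(5) blinfun.bilinear_simps)
      then show "x \<in> ker f" using fgx projections_idem[OF that(1)] by (simp add: ker_def blinfun.add_right)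
    qed
    then have "ker f = ker e" using max f by blast
    moreover have "g x \<in> ker f" for x by (simp add: ker_def fgx)
    ultimately have "e (g x) = 0" for x by (simp add: ker_def)
    then have "g x = 0" for x using fgx projections_idem[OF that(2)] by (simp add: that(5) blinfun.add_left)
    then show False using \<open>g \<noteq> 0\<close> by (metis blinfun_eqI zero_blinfun.rep_eq)
  qed
  have "f \<notin> bad" using *[of f g] fg by blast
  moreover have "g \<notin> bad" using *[of g f] fg projections_compose_commute by (metis add.commute)
  ultimately obtain A B where "small_partition \<zeta> \<eta> f A" "small_partition \<zeta> \<eta> g B"
    using fg by (auto simp: bad_def)
  then have "small_partition \<zeta> \<eta> e (A \<union> B)" using small_partition_add fg by blast
  then show False using e by (auto simp: bad_def)
qed

end


section \<open>Quasi-local operators\<close>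

lemma zero_compose: "(0 :: 'b::real_normed_vector \<Rightarrow>\<^sub>L 'c::real_normed_vector) o\<^sub>L a = 0"
  by (rule blinfun_eqI) simp

section \<open>Coordinate projections and basis vectors\<close>

lemma ell2_eqI: "(\<And>x. ell2_apply f x = ell2_apply g x) \<Longrightarrow> f = g"
  by (simp add: ell2_apply_inject[symmetric] fun_eq_iff)

lemma chi_apply: "ell2_apply (chi A f) x = (if x \<in> A then ell2_apply f x else 0)"
  by (simp add: chi.rep_eq restrict_ell2.rep_eq)

lemma projection_chi: "projection (chi A)"
proof -
  have "cinner (chi A f) g = cinner f (chi A g)" for f g :: "'a ell2"
    unfolding cinner_ell2.rep_eq by (rule infsum_cong) (simp add: chi_apply)
  moreover have "chi A \<in> bounded_ops" "chi A (chi A f) = chi A f" for f :: "'a ell2"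
    by (auto simp: bounded_ops_def chi_apply scaleC_ell2.rep_eq intro!: ell2_eqI)
  ultimately show ?thesis by (simp add: projection_iff)
qed

lemma diff_chi: "f - chi A f = chi (- A) f"
  by (auto simp: chi_apply minus_ell2.rep_eq intro!: ell2_eqI)

lemma chi_chi: "chi A (chi B f) = chi (A \<inter> B) f"
  by (auto simp: chi_apply intro!: ell2_eqI)

lemma chi_empty: "chi {} = 0"
  by (auto simp: chi_apply zero_ell2.rep_eq intro!: ell2_eqI blinfun_eqI)

lift_definition ket :: "'a \<Rightarrow> 'a ell2" is "\<lambda>x y. if y = x then 1 else 0"
  by (rule finite_nonzero_values_imp_summable_on) (auto intro: finite_subset[of _ "{_}"])

lemma cinner_ket: "cinner f (ket x) = ell2_apply f x"
proof -
  have "cinner f (ket x) = (\<Sum>\<^sub>\<infinity>y\<in>{x}. ell2_apply f y * cnj (ell2_apply (ket x) y))"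
    unfolding cinner_ell2.rep_eq by (rule infsum_cong_neutral) (auto simp: ket.rep_eq)
  then show ?thesis by (simp add: ket.rep_eq)
qed

lemma norm_ket: "norm (ket x) = 1"
proof -
  have "(norm (ket x))\<^sup>2 = 1"
    using cinner_self[of "ket x"] by (simp add: cinner_ket ket.rep_eq flip: of_real_power)
  then show ?thesis by (simp add: power2_eq_1_iff) (smt (verit) norm_ge_zero)
qed

lemma norm_chi_finite:
  assumes "finite F"
  shows "(norm (chi F f))\<^sup>2 = (\<Sum>x\<in>F. (cmod (ell2_apply f x))\<^sup>2)"
proof -
  have "(\<Sum>\<^sub>\<infinity>x. (cmod (ell2_apply (chi F f) x))\<^sup>2) = (\<Sum>\<^sub>\<infinity>x\<in>F. (cmod (ell2_apply f x))\<^sup>2)"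
    by (rule infsum_cong_neutral) (auto simp: chi_apply)
  then show ?thesis using assms by (simp add: norm_ell2.rep_eq sum_nonneg)
qed

text \<open>Some finite set carries all but less than \<open>\<epsilon>\<^sup>2\<close> of the
  squared norm of \<open>f\<close>, and any \<open>B n\<close> containing it carries at least as
  much.\<close>

lemma chi_approx:
  fixes B :: "nat \<Rightarrow> 'a set"
  assumes B: "\<And>F. finite F \<Longrightarrow> \<exists>n. F \<subseteq> B n" and "\<epsilon> > 0"
  shows "\<exists>n. norm (f - chi (B n) f) < \<epsilon>"
proof -
  define g where "g x = (cmod (ell2_apply f x))\<^sup>2" for x
  have nf: "(norm f)\<^sup>2 = infsum g UNIV" by (simp add: norm_ell2.rep_eq g_def[abs_def] infsum_nonneg)
  have "(sum g \<longlongrightarrow> infsum g UNIV) (finite_subsets_at_top UNIV)"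
    using ell2_apply[of f] by (intro infsum_tendsto) (simp add: g_def[abs_def])
  then have "\<forall>\<^sub>F F in finite_subsets_at_top UNIV. infsum g UNIV - \<epsilon>\<^sup>2 < sum g F"
    by (rule order_tendstoD) (use \<open>\<epsilon> > 0\<close> in simp)
  then obtain F where F: "finite F" "infsum g UNIV - \<epsilon>\<^sup>2 < sum g F"
    by (auto simp: eventually_finite_subsets_at_top)
  obtain n where n: "F \<subseteq> B n" using B[OF F(1)] by blast
  have "chi F f = chi F (chi (B n) f)" using n by (simp add: chi_chi Int_absorb2)
  then have "norm (chi F f) \<le> norm (chi (B n) f)" using projection_norm_le[OF projection_chi] by metis
  then have "(norm (chi F f))\<^sup>2 \<le> (norm (chi (B n) f))\<^sup>2" by (simp add: power_mono)
  then have "(norm (f - chi (B n) f))\<^sup>2 < \<epsilon>\<^sup>2"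
    using projection_pythagoras[OF projection_chi, of f "B n"] F(2) nf norm_chi_finite[OF F(1), of f]
    by (simp add: g_def)
  then show ?thesis using \<open>\<epsilon> > 0\<close> by (meson less_imp_le power_less_imp_less_base)
qed

text \<open>The scale \<open>r\<close> is a parameter here, so that one scale can be asserted for a
  whole family of operators.\<close>

definition quasi_local_at :: "real \<Rightarrow> real \<Rightarrow> ('x::metric_space ell2 \<Rightarrow>\<^sub>L 'x ell2) \<Rightarrow> bool" where
  "quasi_local_at \<epsilon> r a \<longleftrightarrow> (\<forall>A B. setdist A B > r \<longrightarrow> norm (chi A o\<^sub>L a o\<^sub>L chi B) \<le> \<epsilon>)"

lemma quasi_local_at_mono: "quasi_local_at \<epsilon> r a \<Longrightarrow> r \<le> s \<Longrightarrow> quasi_local_at \<epsilon> s a"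
  by (auto simp: quasi_local_at_def)

lemma norm_compose_contractions:
  assumes "norm a \<le> c" "norm b \<le> 1"
  shows "norm (a o\<^sub>L b) \<le> c"
  using norm_blinfun_compose[of a b] mult_left_mono[OF assms(2), of "norm a"] assms(1) by simp

lemma norm_compose_contractions':
  assumes "norm a \<le> 1" "norm b \<le> c"
  shows "norm (a o\<^sub>L b) \<le> c"
  using norm_blinfun_compose[of a b] mult_right_mono[OF assms(1), of "norm b"] assms(2) by simp

text \<open>The identity is inserted between \<open>a\<close> and \<open>b\<close> as
  \<open>chi C + chi (- C)\<close> for a neighbourhood \<open>C\<close> of \<open>B\<close>:
  \<open>A\<close> is far from \<open>C\<close>, and \<open>- C\<close> is far from
  \<open>B\<close>.\<close>

lemma quasi_local_at_compose:
  assumes a: "quasi_local_at \<epsilon> r a" "norm a \<le> 1" and b: "quasi_local_at \<epsilon>' s b" "norm b \<le> 1"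
    and "r \<ge> 0" "s \<ge> 0" "\<epsilon>' \<ge> 0"
  shows "quasi_local_at (\<epsilon> + \<epsilon>') (r + s + 1) (a o\<^sub>L b)"
  unfolding quasi_local_at_def
proof (intro allI impI)
  fix A B :: "'a set" assume AB: "r + s + 1 < setdist A B"
  then have ne: "A \<noteq> {}" "B \<noteq> {}" using assms(5,6) by auto
  \<comment> \<open>Radius \<open>s + 1\<close> instead of \<open>s\<close> makes the distance from
    \<open>- C\<close> to \<open>B\<close> strictly larger than \<open>s\<close>.\<close>
  define C where "C = {y. \<exists>x\<in>B. dist y x \<le> s + 1}"
  have "setdist A B - (s + 1) \<le> setdist A C"
  proof (rule le_setdistI)
    have "B \<subseteq> C" unfolding C_def using \<open>s \<ge> 0\<close> by (intro subsetI CollectI bexI) auto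
    then show "C \<noteq> {}" using ne(2) by blast
    fix x y assume "x \<in> A" "y \<in> C"
    then obtain z where z: "z \<in> B" "dist y z \<le> s + 1" by (auto simp: C_def)
    then show "setdist A B - (s + 1) \<le> dist x y"
      using setdist_le_dist[OF \<open>x \<in> A\<close> z(1)] dist_triangle[of x z y] by linarith
  qed (use ne in blast)
  then have AC: "norm (chi A o\<^sub>L a o\<^sub>L chi C) \<le> \<epsilon>"
    using a(1) AB by (simp add: quasi_local_at_def)
  have CB: "norm (chi (- C) o\<^sub>L b o\<^sub>L chi B) \<le> \<epsilon>'"
  \<comment> \<open>The empty set has \<open>setdist\<close> 0, so quasi-locality says nothing about
    it; here the operator itself vanishes.\<close>
  proof (cases "- C = {}")
    case True
    then show ?thesis using \<open>\<epsilon>' \<ge> 0\<close> by (simp only: chi_empty) (simp add: zero_compose)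
  next
    case False
    have "s + 1 \<le> setdist (- C) B"
      by (rule le_setdistI) (use False ne in \<open>auto simp: C_def not_le less_imp_le\<close>)
    then show ?thesis using b(1) by (simp add: quasi_local_at_def)
  qed
  have chi1: "norm (chi A :: 'a ell2 \<Rightarrow>\<^sub>L 'a ell2) \<le> 1" for A
    by (rule projection_norm_le_1[OF projection_chi])
  have "chi A o\<^sub>L (a o\<^sub>L b) o\<^sub>L chi B =
      ((chi A o\<^sub>L a o\<^sub>L chi C) o\<^sub>L (b o\<^sub>L chi B)) + ((chi A o\<^sub>L a) o\<^sub>L (chi (- C) o\<^sub>L b o\<^sub>L chi B))"
    by (rule blinfun_eqI) (simp add: blinfun.add_left blinfun.diff_right diff_chi[symmetric])
  also have "norm \<dots> \<le> \<epsilon> + \<epsilon>'"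
    by (intro norm_triangle_mono norm_compose_contractions[OF AC] norm_compose_contractions'[OF _ CB]
        norm_compose_contractions[OF b(2) chi1] norm_compose_contractions[OF chi1 a(2)])
  finally show "norm (chi A o\<^sub>L (a o\<^sub>L b) o\<^sub>L chi B) \<le> \<epsilon> + \<epsilon>'" .
qed

section \<open>Homomorphisms into the quasi-local algebra\<close>

locale quasi_local_representation = diffuse_abelian_von_neumann_algebra D
  for D :: "('h::chilbert_space \<Rightarrow>\<^sub>L 'h) set" +
  fixes \<phi> :: "('h \<Rightarrow>\<^sub>L 'h) \<Rightarrow> ('x::metric_space ell2 \<Rightarrow>\<^sub>L 'x ell2)"
  assumes hom: "star_hom D quasi_local_algebra \<phi>"
begin

lemma hom_add: "a \<in> projections \<Longrightarrow> b \<in> projections \<Longrightarrow> \<phi> (a + b) = \<phi> a + \<phi> b"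
  and hom_compose: "a \<in> projections \<Longrightarrow> b \<in> projections \<Longrightarrow> \<phi> (a o\<^sub>L b) = \<phi> a o\<^sub>L \<phi> b"
  using hom by (auto simp: star_hom_def projections_def)

lemma hom_zero: "\<phi> 0 = 0"
  using hom_add[OF zero_in_projections zero_in_projections] by simp

lemma hom_projection: "p \<in> projections \<Longrightarrow> projection (\<phi> p)"
  using hom unfolding projections_def star_hom_def quasi_local_algebra_def projection_def
  by (metis (mono_tags, lifting) mem_Collect_eq)

lemma hom_idem: "p \<in> projections \<Longrightarrow> \<phi> p (\<phi> p x) = \<phi> p x"
  using hom_projection by (simp add: projection_iff)

lemma hom_sum:
  assumes "finite I" "\<And>i. i \<in> I \<Longrightarrow> p i \<in> projections"
    and "\<And>i j. i \<in> I \<Longrightarrow> j \<in> I \<Longrightarrow> i \<noteq> j \<Longrightarrow> p i o\<^sub>L p j = 0"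
  shows "\<phi> (\<Sum>i\<in>I. p i) = (\<Sum>i\<in>I. \<phi> (p i))"
  using assms
proof (induction I)
  case (insert a I)
  then show ?case using sum_projections[of I p] by (simp add: hom_add)
qed (simp add: hom_zero)

lemma hom_quasi_local:
  assumes "p \<in> projections" "\<epsilon> > 0"
  shows "\<exists>r>0. quasi_local_at \<epsilon> r (\<phi> p)"
  using hom assms unfolding star_hom_def quasi_local_algebra_def quasi_local_at_def projections_def by blast

text \<open>If the conclusion failed for every member of an orthogonal sequence \<open>q n\<close>, one could choose
  \<open>p n \<le> q n\<close> less and less local, relative to the locality of \<open>\<phi> (q n)\<close>. The supremum \<open>a\<close> of the
  \<open>p n\<close> satisfies \<open>\<phi> (p n) = \<phi> a \<phi> (q n)\<close> even if \<open>\<phi>\<close> is not normal, which bounds the locality of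
  \<open>\<phi> (p n)\<close> in terms of that of \<open>\<phi> a\<close>.\<close>

lemma uniformly_quasi_local_corner:
  assumes "D \<noteq> {0}" "\<epsilon> > 0"
  obtains q r where "q \<in> projections" "q \<noteq> 0" "r > 0"
    "\<And>p. p \<in> projections \<Longrightarrow> p o\<^sub>L q = p \<Longrightarrow> quasi_local_at \<epsilon> r (\<phi> p)"
proof (rule ccontr)
  assume contra: "\<not> thesis"
  obtain q where q: "\<And>n::nat. q n \<in> projections" "\<And>n. q n \<noteq> 0" and orth: "\<And>m n. m \<noteq> n \<Longrightarrow> q m o\<^sub>L q n = 0"
    using orthogonal_sequence[OF assms(1)] by blast
  have "\<exists>r>0. quasi_local_at (\<epsilon>/2) r (\<phi> (q n))" for n
    by (rule hom_quasi_local) (use q(1) assms(2) in auto)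
  then obtain r where r: "\<And>n. r n > 0" "\<And>n. quasi_local_at (\<epsilon>/2) (r n) (\<phi> (q n))" by metis
  \<comment> \<open>Once \<open>n \<ge> s\<close>, this scale is at least
    \<open>s + r n + 1\<close>, the one at which the composition of \<open>\<phi> a\<close> and
    \<open>\<phi> (q n)\<close> is local.\<close>
  have "\<exists>p\<in>projections. p o\<^sub>L q n = p \<and> \<not> quasi_local_at \<epsilon> (real n + r n + 1) (\<phi> p)" for n
  proof (rule ccontr)
    assume "\<not> ?thesis"
    then show False using that[OF q(1) q(2), of "real n + r n + 1" n] contra r(1)[of n] by fastforce
  qed
  then obtain p where p: "\<And>n. p n \<in> projections" "\<And>n. p n o\<^sub>L q n = p n"
    "\<And>n. \<not> quasi_local_at \<epsilon> (real n + r n + 1) (\<phi> (p n))" by metis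
  obtain a where a: "a \<in> projections" "\<And>n. a o\<^sub>L q n = p n"
    using orthogonal_sup[of q p, OF q(1) orth p(1,2)] by blast
  obtain s where s: "s > 0" "quasi_local_at (\<epsilon>/2) s (\<phi> a)"
    using hom_quasi_local[OF a(1), of "\<epsilon>/2"] assms(2) by auto
  obtain n where n: "s \<le> real n" using real_arch_simple by blast
  have "quasi_local_at (\<epsilon>/2 + \<epsilon>/2) (s + r n + 1) (\<phi> a o\<^sub>L \<phi> (q n))"
    by (intro quasi_local_at_compose s r projection_norm_le_1 hom_projection a q less_imp_le)
       (use assms s r in auto)
  then have "quasi_local_at \<epsilon> (s + r n + 1) (\<phi> (p n))"
    using hom_compose[OF a(1) q(1)] a(2) by (simp add: field_simps)
  then show False using p(3)[of n] n quasi_local_at_mono by fastforce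
qed


text \<open>For the pieces \<open>a\<close> of a fine partition of unity put \<open>E a = \<phi> (a q)\<close>. Discard the boundedly many
  pieces with \<open>\<parallel>E a \<delta>\<^sub>x\<parallel>\<close> large for some \<open>x\<close> in the \<open>r\<close>-neighbourhood \<open>F\<close> of \<open>B\<close>. For \<open>y\<close> supported
  in \<open>B\<close> and the remaining pieces, \<open>\<Sum>\<parallel>\<chi>\<^sub>F (E a y)\<parallel>\<^sup>2\<close> is small since
  \<open>\<langle>E a y, \<delta>\<^sub>x\<rangle> = \<langle>E a y, E a \<delta>\<^sub>x\<rangle>\<close>, while \<open>\<Sum>\<parallel>\<chi>\<^sub>-\<^sub>F (E a y)\<parallel>\<^sup>2\<close> is small by quasi-locality, uniform over
  all partial sums of the \<open>E a\<close>, and a choice of signs.\<close>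

lemma small_projection_carrying_finite_set:
  fixes B :: "'x set" and \<zeta> :: 'h
  assumes ulf: "uniformly_locally_finite TYPE('x)"
    and q: "q \<in> projections" and "r > 0"
    and ql: "\<And>p. p \<in> projections \<Longrightarrow> p o\<^sub>L q = p \<Longrightarrow> quasi_local_at (1/8) r (\<phi> p)"
    and B: "finite B" and "\<kappa> > 0"
  shows "\<exists>p\<in>projections. p o\<^sub>L q = p \<and> norm (p \<zeta>) \<le> \<kappa> \<and>
    (\<forall>\<xi>. norm (\<phi> (q - p) (chi B \<xi>)) \<le> norm \<xi> / 2)"
proof -
  \<comment> \<open>The extra 1 puts the complement of \<open>F\<close> at distance strictly greater
    than \<open>r\<close> from \<open>B\<close>.\<close>
  define F where "F = (\<Union>x\<in>B. cball x (r + 1))"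
  have "finite (cball x (r + 1))" for x :: 'x
    using ulf \<open>r > 0\<close> by (auto simp: uniformly_locally_finite_def dest!: spec[of _ "r + 1"])
  then have F: "finite F" using B by (simp add: F_def)
  have far: "norm (chi (- F) (\<phi> p (chi B \<xi>))) \<le> norm \<xi> / 8" if "p \<in> projections" "p o\<^sub>L q = p" for p \<xi>
  proof (cases "- F = {} \<or> B = {}")
    case True
    then have "(chi (- F) :: 'x ell2 \<Rightarrow>\<^sub>L 'x ell2) = 0 \<or> (chi B :: 'x ell2 \<Rightarrow>\<^sub>L 'x ell2) = 0"
      using chi_empty by metis
    then show ?thesis by (auto simp: blinfun.zero_right)
  next
    case False
    have "r + 1 \<le> setdist (- F) B"
      by (rule le_setdistI) (use False in \<open>auto simp: F_def dist_commute not_le less_imp_le\<close>)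
    then have "norm (chi (- F) o\<^sub>L \<phi> p o\<^sub>L chi B) \<le> 1/8"
      using ql[OF that] by (simp add: quasi_local_at_def)
    then have "norm ((chi (- F) o\<^sub>L \<phi> p o\<^sub>L chi B) \<xi>) \<le> 1/8 * norm \<xi>"
      by (rule order_trans[OF norm_blinfun mult_right_mono]) simp
    then show ?thesis by simp
  qed
  define M where "M = real (card F)"
  \<comment> \<open>Chosen so that \<open>M * \<delta> \<le> 1/16\<close>, also when
    \<open>F\<close> is empty.\<close>
  define \<delta> where "\<delta> = 1 / (16 * (M + 1))"
  \<comment> \<open>Will bound the number of big pieces: Bessel's inequality at each of the
    \<open>M\<close> basis vectors over \<open>F\<close> gives
    \<open>card big * \<delta> \<le> M\<close>.\<close>
  define L where "L = M / \<delta>"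
  have M: "M \<ge> 0" by (simp add: M_def)
  then have \<delta>: "\<delta> > 0" "M * \<delta> \<le> 1/16" by (simp_all add: \<delta>_def field_simps)
  have L: "L \<ge> 0" using M \<delta> by (simp add: L_def)
  \<comment> \<open>At most \<open>L\<close> pieces will enter \<open>p\<close>, so this smallness
    at \<open>q \<zeta>\<close> keeps the norm of \<open>p \<zeta>\<close> below
    \<open>\<kappa>\<close>.\<close>
  obtain A where A: "small_partition (q \<zeta>) (\<kappa> / (L + 1)) id_blinfun A"
    using small_partition_exists[of "\<kappa> / (L + 1)"] \<open>\<kappa> > 0\<close> L by (metis add_nonneg_pos divide_pos_pos zero_less_one)
  have fA: "finite A" and Ap: "\<And>a. a \<in> A \<Longrightarrow> a \<in> projections"
    and sumA: "\<Sum>A = id_blinfun" and A\<zeta>: "\<And>a. a \<in> A \<Longrightarrow> norm (a (q \<zeta>)) \<le> \<kappa> / (L + 1)"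
    and Aorth: "\<And>a b. a \<in> A \<Longrightarrow> b \<in> A \<Longrightarrow> a \<noteq> b \<Longrightarrow> a o\<^sub>L b = 0"
    using A by (auto simp: small_partition_def)
  define E where "E a = \<phi> (a o\<^sub>L q)" for a
  have aq: "a o\<^sub>L q \<in> projections" if "a \<in> A" for a using projections_compose Ap q that by blast
  have aq_orth: "(a o\<^sub>L q) o\<^sub>L (b o\<^sub>L q) = 0" if "a \<in> A" "b \<in> A" "a \<noteq> b" for a b
  proof -
    have "a (q (b (q x))) = q (a (b (q x)))" for x using projections_commute[OF Ap q] that by simp
    moreover have "a (b x) = 0" for x
      using Aorth[OF that] by (metis blinfun_apply_blinfun_compose zero_blinfun.rep_eq)
    ultimately show ?thesis by (auto intro!: blinfun_eqI simp: blinfun.zero_right)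
  qed
  define P where "P T = (\<Sum>a\<in>T. a o\<^sub>L q)" for T :: "('h \<Rightarrow>\<^sub>L 'h) set"
  have P: "P T \<in> projections" "\<And>y. \<phi> (P T) y = (\<Sum>a\<in>T. E a y)" if "T \<subseteq> A" for T
  proof -
    have "finite T" using that fA finite_subset by blast
    then show "P T \<in> projections" "\<And>y. \<phi> (P T) y = (\<Sum>a\<in>T. E a y)"
      using that sum_projections[of T "\<lambda>a. a o\<^sub>L q"] hom_sum[of T "\<lambda>a. a o\<^sub>L q"] aq aq_orth
      by (auto simp: P_def E_def blinfun.sum_left subset_iff)
  qed
  have Pq: "P T o\<^sub>L q = P T" for T
    by (rule blinfun_eqI) (simp add: P_def blinfun.sum_left projections_idem[OF q])
  have PA: "P A = q"
  proof (rule blinfun_eqI)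
    fix x
    have "P A x = (\<Sum>A) (q x)" by (simp add: P_def blinfun.sum_left)
    then show "P A x = q x" by (simp add: sumA)
  qed
  have E: "projection (E a)" if "a \<in> A" for a unfolding E_def by (rule hom_projection[OF aq[OF that]])
  have E_orth: "cinner (E a y) (E b z) = 0" if "a \<in> A" "b \<in> A" "a \<noteq> b" for a b y z
  proof -
    have "cinner (E a y) (E b z) = cinner y (E a (E b z))" using E[OF that(1)] by (simp add: projection_iff)
    also have "E a (E b z) = \<phi> ((a o\<^sub>L q) o\<^sub>L (b o\<^sub>L q)) z"
      unfolding E_def using hom_compose[OF aq aq] that by simp
    finally show ?thesis by (simp add: aq_orth[OF that] hom_zero)
  qed
  have norm_P: "(norm (\<phi> (P T) y))\<^sup>2 = (\<Sum>a\<in>T. (norm (E a y))\<^sup>2)" if T: "T \<subseteq> A" for T y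
    unfolding P(2)[OF T] using T fA by (intro norm_sum_orthogonal E_orth) (auto intro: finite_subset)
  have bessel: "(\<Sum>a\<in>T. (norm (E a y))\<^sup>2) \<le> (norm y)\<^sup>2" if T: "T \<subseteq> A" for T y
    unfolding norm_P[OF T, symmetric]
    by (intro power_mono projection_norm_le hom_projection P[OF T]) simp
  define big where "big = {a \<in> A. \<exists>x\<in>F. \<delta> \<le> (norm (E a (ket x)))\<^sup>2}"
  define small where "small = A - big"
  have sub: "big \<subseteq> A" "small \<subseteq> A" and fin: "finite big" "finite small"
    using fA by (auto simp: big_def small_def)
  have "real (card big) * \<delta> = (\<Sum>a\<in>big. \<delta>)" by simp
  also have "\<dots> \<le> (\<Sum>a\<in>big. \<Sum>x\<in>F. (norm (E a (ket x)))\<^sup>2)"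
  proof (rule sum_mono)
    fix a assume "a \<in> big"
    then obtain x where "x \<in> F" "\<delta> \<le> (norm (E a (ket x)))\<^sup>2" by (auto simp: big_def)
    then show "\<delta> \<le> (\<Sum>x\<in>F. (norm (E a (ket x)))\<^sup>2)"
      using member_le_sum[of x F "\<lambda>x. (norm (E a (ket x)))\<^sup>2"] F by fastforce
  qed
  also have "\<dots> = (\<Sum>x\<in>F. \<Sum>a\<in>big. (norm (E a (ket x)))\<^sup>2)" by (rule sum.swap)
  also have "\<dots> \<le> (\<Sum>x\<in>F. 1)"
    by (rule sum_mono) (use bessel[OF sub(1), of "ket _"] in \<open>simp add: norm_ket\<close>)
  finally have "real (card big) \<le> L" using \<delta> by (simp add: L_def M_def field_simps)
  have "norm (P big \<zeta>) \<le> (\<Sum>a\<in>big. norm (blinfun_apply a (q \<zeta>)))"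
    by (simp add: P_def blinfun.sum_left norm_sum)
  also have "\<dots> \<le> (\<Sum>a\<in>big. \<kappa> / (L + 1))" by (rule sum_mono) (use A\<zeta> sub in auto)
  also have "\<dots> = real (card big) * (\<kappa> / (L + 1))" by simp
  also have "\<dots> \<le> (L + 1) * (\<kappa> / (L + 1))"
    using \<open>real (card big) \<le> L\<close> \<open>\<kappa> > 0\<close> L by (intro mult_right_mono) auto
  also have "\<dots> = \<kappa>" using L by simp
  finally have \<kappa>: "norm (P big \<zeta>) \<le> \<kappa>" .
  have "P A = P big + P small"
    unfolding P_def small_def using sum.subset_diff[OF sub(1) fA] by (simp add: add.commute)
  then have diff: "q - P big = P small" by (simp add: PA)
  have "norm (\<phi> (q - P big) (chi B \<xi>)) \<le> norm \<xi> / 2" for \<xi>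
  proof -
    define y where "y = chi B \<xi>"
    have y: "norm y \<le> norm \<xi>" unfolding y_def by (rule projection_norm_le[OF projection_chi])
    obtain T where T: "T \<subseteq> small" and signs: "(\<Sum>a\<in>small. (norm (chi (- F) (E a y)))\<^sup>2) \<le>
        (norm ((\<Sum>a\<in>T. chi (- F) (E a y)) - (\<Sum>a\<in>small - T. chi (- F) (E a y))))\<^sup>2"
      using exists_signs[OF fin(2), of "\<lambda>a. chi (- F) (E a y)"] by blast
    have part: "norm (\<Sum>a\<in>S. chi (- F) (E a y)) \<le> norm \<xi> / 8" if "S \<subseteq> A" for S
      using far[OF P(1)[OF that] Pq, of \<xi>] by (simp add: P(2)[OF that] blinfun.sum_right y_def)
    have "norm ((\<Sum>a\<in>T. chi (- F) (E a y)) - (\<Sum>a\<in>small - T. chi (- F) (E a y))) \<le> norm \<xi> / 8 + norm \<xi> / 8"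
      by (intro order_trans[OF norm_triangle_ineq4] add_mono part) (use T sub in auto)
    then have "(norm ((\<Sum>a\<in>T. chi (- F) (E a y)) - (\<Sum>a\<in>small - T. chi (- F) (E a y))))\<^sup>2 \<le> (norm \<xi> / 4)\<^sup>2"
      by (intro power_mono) auto
    with signs have out: "(\<Sum>a\<in>small. (norm (chi (- F) (E a y)))\<^sup>2) \<le> (norm \<xi>)\<^sup>2 / 16"
      by (simp add: power_divide)
    have "(norm (chi F (E a y)))\<^sup>2 \<le> M * \<delta> * (norm (E a y))\<^sup>2" if a: "a \<in> small" for a
    proof -
      have "(cmod (ell2_apply (E a y) x))\<^sup>2 \<le> \<delta> * (norm (E a y))\<^sup>2" if x: "x \<in> F" for x
      proof -
        have pa: "projection (E a)" using E a sub by blast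
        have "ell2_apply (E a y) x = cinner (E a (E a y)) (ket x)"
          using pa by (simp add: cinner_ket projection_iff)
        also have "\<dots> = cinner (E a y) (E a (ket x))" using pa by (simp add: projection_iff)
        finally have "cmod (ell2_apply (E a y) x) \<le> norm (E a y) * norm (E a (ket x))"
          using cmod_cinner_le by metis
        then have "(cmod (ell2_apply (E a y) x))\<^sup>2 \<le> (norm (E a y) * norm (E a (ket x)))\<^sup>2"
          by (intro power_mono) auto
        also have "\<dots> = (norm (E a (ket x)))\<^sup>2 * (norm (E a y))\<^sup>2" by (simp add: power_mult_distrib)
        also have "\<dots> \<le> \<delta> * (norm (E a y))\<^sup>2"
          using a x by (intro mult_right_mono) (auto simp: small_def big_def)
        finally show ?thesis .
      qed
      then have "(\<Sum>x\<in>F. (cmod (ell2_apply (E a y) x))\<^sup>2) \<le> (\<Sum>x\<in>F. \<delta> * (norm (E a y))\<^sup>2)"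
        by (rule sum_mono)
      then show ?thesis by (simp add: norm_chi_finite[OF F] M_def mult.assoc)
    qed
    then have "(\<Sum>a\<in>small. (norm (chi F (E a y)))\<^sup>2) \<le> M * \<delta> * (\<Sum>a\<in>small. (norm (E a y))\<^sup>2)"
      unfolding sum_distrib_left by (rule sum_mono)
    also have "\<dots> \<le> 1/16 * (norm \<xi>)\<^sup>2"
      using \<delta> order_trans[OF bessel[OF sub(2), of y] power_mono[OF y norm_ge_zero, of 2]]
      by (intro mult_mono) (auto intro: sum_nonneg)
    finally have "in": "(\<Sum>a\<in>small. (norm (chi F (E a y)))\<^sup>2) \<le> (norm \<xi>)\<^sup>2 / 16" by simp
    have "(norm (\<phi> (P small) y))\<^sup>2 =
        (\<Sum>a\<in>small. (norm (chi F (E a y)))\<^sup>2) + (\<Sum>a\<in>small. (norm (chi (- F) (E a y)))\<^sup>2)"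
      unfolding norm_P[OF sub(2)] sum.distrib[symmetric]
      by (rule sum.cong[OF refl]) (rule projection_pythagoras[OF projection_chi, of _ F, unfolded diff_chi])
    \<comment> \<open>The parts inside and outside \<open>F\<close> contribute \<open>1/16\<close>
      each; the sum is below the allowed \<open>1/4\<close>.\<close>
    also have "\<dots> \<le> (norm \<xi>)\<^sup>2 / 8" using "in" out by simp
    also have "\<dots> \<le> (norm \<xi> / 2)\<^sup>2" by (simp add: power_divide)
    finally show ?thesis unfolding diff y_def[symmetric] by (rule power2_le_imp_le) simp
  qed
  then show ?thesis using P(1)[OF sub(1)] Pq[of big] \<kappa> by blast
qed

text \<open>All \<open>p n\<close> are removed from \<open>q\<close> at once by projecting onto the
  vectors of the range of \<open>q\<close> that every \<open>p n\<close> kills. The resulting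
  \<open>s\<close> lies below each \<open>q - p n\<close>, and this relation passes to
  \<open>\<phi>\<close> by multiplicativity alone.\<close>

lemma not_injective:
  assumes ulf: "uniformly_locally_finite TYPE('x)" and "D \<noteq> {0}"
  shows "\<not> inj_on \<phi> D"
proof
  assume inj: "inj_on \<phi> D"
  obtain q r where q: "q \<in> projections" "q \<noteq> 0" "r > 0"
    and ql: "\<And>p. p \<in> projections \<Longrightarrow> p o\<^sub>L q = p \<Longrightarrow> quasi_local_at (1/8) r (\<phi> p)"
    using uniformly_quasi_local_corner[OF assms(2), of "1/8"] by auto
  obtain z where z: "q z \<noteq> 0" using q(2) by (metis blinfun_eqI zero_blinfun.rep_eq)
  define \<zeta> where "\<zeta> = q z /\<^sub>R norm (q z)"
  have \<zeta>: "q \<zeta> = \<zeta>" "norm \<zeta> = 1"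
    using z by (simp_all add: \<zeta>_def blinfun.scaleR_right projections_idem[OF q(1)])
  \<comment> \<open>An arbitrary point serves as centre; \<open>Suc n\<close> keeps the radius
    positive, as uniform local finiteness speaks of positive radii only.\<close>
  define B :: "nat \<Rightarrow> 'x set" where "B n = cball undefined (real (Suc n))" for n
  have B: "finite (B n)" for n
    using ulf by (auto simp: B_def uniformly_locally_finite_def dest!: spec[of _ "real (Suc n)"])
  have exh: "\<exists>n. F \<subseteq> B n" if "finite F" for F
  proof -
    obtain n where n: "(\<Sum>x\<in>F. dist undefined x) \<le> real n" using real_arch_simple by blast
    have "dist undefined x \<le> real (Suc n)" if "x \<in> F" for x
      using member_le_sum[OF that, of "dist undefined"] \<open>finite F\<close> n by simp
    then show ?thesis by (intro exI[of _ n]) (auto simp: B_def)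
  qed
  \<comment> \<open>These bounds sum to \<open>1/2\<close>, less than the norm of
    \<open>\<zeta>\<close>, so the removals cannot exhaust \<open>\<zeta>\<close>.\<close>
  have "\<exists>p\<in>projections. p o\<^sub>L q = p \<and> norm (p \<zeta>) \<le> 1/4 * (1/2) ^ n \<and>
    (\<forall>\<xi>. norm (\<phi> (q - p) (chi (B n) \<xi>)) \<le> norm \<xi> / 2)" for n
    by (rule small_projection_carrying_finite_set[OF ulf q(1) q(3) ql B]) auto
  then obtain p where p: "\<And>n. p n \<in> projections" and pq: "\<And>n. p n o\<^sub>L q = p n"
    and p\<zeta>: "\<And>n. norm (p n \<zeta>) \<le> 1/4 * (1/2) ^ n"
    and p\<phi>: "\<And>n \<xi>. norm (\<phi> (q - p n) (chi (B n) \<xi>)) \<le> norm \<xi> / 2" by metis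
  \<comment> \<open>Partial removals: the product of \<open>q\<close> and the complements of the
    first \<open>n\<close> projections \<open>p k\<close>.\<close>
  define e where "e n = rec_nat q (\<lambda>k e. e o\<^sub>L (id_blinfun - p k)) n" for n
  have e0: "e 0 = q" and eS: "e (Suc n) = e n o\<^sub>L (id_blinfun - p n)" for n by (simp_all add: e_def)
  have e: "e n \<in> projections" for n
    by (induction n) (simp_all add: e0 eS q projections_compose projections_compl p)
  have eSx: "e (Suc n) x = e n x - e n (p n x)" for n x by (simp add: eS blinfun.diff_left blinfun.diff_right)
  have e_lim: "e n \<zeta> = \<zeta> - (\<Sum>k<n. e k (p k \<zeta>))" for n
    by (induction n) (simp_all add: e0 \<zeta> eSx)
  have bound: "norm (e k (p k \<zeta>)) \<le> 1/4 * (1/2) ^ k" for k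
  proof -
    have "projection (e k)" using e by (simp add: projections_def)
    then show ?thesis using projection_norm_le p\<zeta> order_trans by blast
  qed
  have geo: "(\<lambda>k. 1/4 * (1/2) ^ k) sums (1/2 :: real)"
    using sums_mult[OF geometric_sums[of "1/2 :: real"], of "1/4"] by simp
  have summ: "summable (\<lambda>k. e k (p k \<zeta>))"
    by (rule summable_comparison_test'[OF sums_summable[OF geo]]) (rule bound)
  define v where "v = \<zeta> - (\<Sum>k. e k (p k \<zeta>))"
  have v: "(\<lambda>n. e n \<zeta>) \<longlonglongrightarrow> v"
    unfolding e_lim v_def by (intro tendsto_intros summable_LIMSEQ[OF summ])
  have "norm (\<zeta> - v) \<le> 1/2"
    using norm_suminf_le[OF bound sums_summable[OF geo]]
    unfolding v_def sums_unique[OF geo, symmetric] by simp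
  then have "v \<noteq> 0" using \<zeta> by auto
  \<comment> \<open>Once the complement of \<open>p k\<close> is a factor of \<open>e n\<close>,
    commutativity makes \<open>p k\<close> annihilate the range of \<open>e n\<close>; this persists
    for later \<open>n\<close>.\<close>
  have pe: "p k (e n x) = 0" if "k < n" for k n x
    using that
  proof (induction n arbitrary: x)
    case (Suc n)
    show ?case
    proof (cases "k = n")
      case True
      then show ?thesis
        using projections_commute[OF p e] projections_idem[OF p] by (simp add: eSx blinfun.diff_right)
    qed (use Suc in \<open>simp add: eSx blinfun.diff_right\<close>)
  qed simp
  have qe: "q (e n x) = e n x" for n x
    by (induction n arbitrary: x) (simp_all add: e0 eSx projections_idem[OF q(1)] blinfun.diff_right)
  have "(\<lambda>n. q (e n \<zeta>)) \<longlonglongrightarrow> q v" by (intro tendsto_intros v)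
  then have qv: "q v = v" using v qe LIMSEQ_unique by auto
  have pv: "p k v = 0" for k
  proof (rule LIMSEQ_unique)
    show "(\<lambda>n. p k (e n \<zeta>)) \<longlonglongrightarrow> p k v" by (intro tendsto_intros v)
    show "(\<lambda>n. p k (e n \<zeta>)) \<longlonglongrightarrow> 0"
      by (rule tendsto_eventually) (rule eventually_mono[OF eventually_gt_at_top[of k]], rule pe)
  qed
  have "insert (id_blinfun - q) (range p) \<subseteq> D"
    using p projections_compl[OF q(1)] by (auto simp: projections_def)
  then obtain s where s: "s \<in> projections"
    and sx: "\<And>x. s x = x \<longleftrightarrow> (\<forall>a\<in>insert (id_blinfun - q) (range p). a x = 0)"
    by (rule kernel_projection) blast
  have "s v = v" using sx qv pv by (auto simp: blinfun.diff_left)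
  then have "s \<noteq> 0" using \<open>v \<noteq> 0\<close> by auto
  moreover have "s \<in> D" "0 \<in> D" using s zero_in_projections by (auto simp: projections_def)
  ultimately have "\<phi> s \<noteq> 0" using inj hom_zero by (metis inj_onD)
  then obtain y where y: "\<phi> s y \<noteq> 0" by (metis blinfun_eqI zero_blinfun.rep_eq)
  define \<xi> where "\<xi> = \<phi> s y"
  have \<xi>: "\<phi> s \<xi> = \<xi>" "norm \<xi> > 0" using y hom_idem[OF s] by (simp_all add: \<xi>_def)
  obtain n where n: "norm (\<xi> - chi (B n) \<xi>) < norm \<xi> / 4"
    using chi_approx[OF exh, of "norm \<xi> / 4" \<xi>] \<xi>(2) by auto
  have qp: "q - p n \<in> projections" by (rule projections_diff[OF p q(1) pq])
  \<comment> \<open>Every vector in the range of \<open>s\<close> is fixed by \<open>q\<close> and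
    killed by \<open>p n\<close>, so \<open>s\<close> lies below \<open>q - p n\<close>.\<close>
  have "s x = s (q x - p n x)" for x
  proof -
    have "q (s x) - p n (s x) = s x"
      using sx[of "s x"] projections_idem[OF s] by (auto simp: blinfun.diff_left)
    then show ?thesis using projections_commute[OF s q(1)] projections_commute[OF s p] by (simp add: blinfun.diff_right)
  qed
  then have "s = s o\<^sub>L (q - p n)" by (auto intro!: blinfun_eqI simp: blinfun.diff_left)
  then have s\<phi>: "\<phi> s x = \<phi> s (\<phi> (q - p n) x)" for x
    using hom_compose[OF s qp] by (metis blinfun_apply_blinfun_compose)
  have contr: "norm (\<phi> s x) \<le> norm x" for x by (rule projection_norm_le[OF hom_projection[OF s]])
  \<comment> \<open>Both terms together have norm at most three quarters of that of
    \<open>\<xi>\<close>, although \<open>\<phi> s\<close> fixes \<open>\<xi>\<close>.\<close>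
  have "\<xi> = \<phi> s (chi (B n) \<xi>) + \<phi> s (\<xi> - chi (B n) \<xi>)" by (simp add: \<xi> blinfun.diff_right)
  also have "norm \<dots> \<le> norm \<xi> / 2 + norm \<xi> / 4"
  proof (rule norm_triangle_mono)
    show "norm (\<phi> s (chi (B n) \<xi>)) \<le> norm \<xi> / 2"
      unfolding s\<phi>[of "chi (B n) \<xi>"] using contr p\<phi> order_trans by blast
    show "norm (\<phi> s (\<xi> - chi (B n) \<xi>)) \<le> norm \<xi> / 4"
      using contr[of "\<xi> - chi (B n) \<xi>"] n by linarith
  qed
  finally show False using \<xi>(2) by simp
qed

end

theorem theorem1p4:
  fixes D :: "('h::chilbert_space \<Rightarrow>\<^sub>L 'h) set"
  assumes "infinite (UNIV :: 'x::metric_space set)"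
    and "uniformly_locally_finite TYPE('x)"
    and "von_neumann_algebra D" and "abelian D" and "diffuse D" and "D \<noteq> {0}"
  shows "\<not> (\<exists>\<phi>. star_hom D (quasi_local_algebra :: ('x ell2 \<Rightarrow>\<^sub>L 'x ell2) set) \<phi> \<and> inj_on \<phi> D)"
proof
  assume "\<exists>\<phi>. star_hom D (quasi_local_algebra :: ('x ell2 \<Rightarrow>\<^sub>L 'x ell2) set) \<phi> \<and> inj_on \<phi> D"
  then obtain \<phi> where \<phi>: "star_hom D (quasi_local_algebra :: ('x ell2 \<Rightarrow>\<^sub>L 'x ell2) set) \<phi>" "inj_on \<phi> D"
    by blast
  interpret quasi_local_representation D \<phi>
    by unfold_locales (use assms \<phi> in auto)
  show False using not_injective assms \<phi>(2) by blast
qed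

end
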